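(* In a McVittie spacetime with $K>0$ (normalised to $K=+1$), there exists a spacelike hypersurface $\Sigma_0=\{(t,r):t\in I_0,\ r=r_0(t)\}$, which is a subset of the allowed region, along which the pressure is infinite (i.e. $P$ diverges). The weak energy condition is violated throughout one of the regions $\mathcal{R}_1$ or $\mathcal{R}_2$, where $$\mathcal{R}_1=\{(t,r):t\in I_0,\ r_1(t)<r<r_0(t)\},\qquad \mathcal{R}_2=\{(t,r):t\in I_0,\ r_0(t)<r<r_2(t)\}.$$
   Context: $M>0$ and $\Lambda\in\mathbb{R}$ are constants, $K=+1$, $a\in C^2(I,\mathbb{R}_+)$ on a maximal interval $I$, $H=a'/a$, $\kappa(t,r)=1-\frac{2M}{r}-\frac{r^2}{a^2(t)}$. The FLRW background satisfies the energy condition $\mu_{FLRW}+P_{FLRW}>0$, equivalently $H'-Ka^{-2}<0$ on $I$, and $\mu_{FLRW}>0$, where $8\pi\mu_{FLRW}+\Lambda=3(H^2+Ka^{-2})$, $8\pi P_{FLRW}-\Lambda=-2H'-3H^2-Ka^{-2}$. $I_0$ is the set of $t\in I$ with $a(t)>3\sqrt3M$ and $H(t)\ne0$. For such $t$, $\kappa(t,\cdot)$ has exactly two positive zeros $r_1(t)<r_2(t)$, and $\kappa>0$ exactly on $(r_1(t),r_2(t))$; the allowed region is the set where $\kappa>0$. The metric is $$ds^2=-\sigma^2(H^{-2}-r^2\kappa^{-1})dt^2-2\sigma r\kappa^{-1}dt\,dr+\kappa^{-1}dr^2+r^2d\omega^2,$$ $$\sigma(t,r)=s_M(t)\kappa^{1/2}+\frac{H}{a^2}\kappa^{1/2}\int_{3M}^r\bar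 r\,\kappa^{-3/2}(t,\bar r)\,d\bar r,$$ with $s_M(t)$ a function of $t$ depending on the parameter $M$ with $\lim_{M\to0}s_M(t)=H(t)$, otherwise arbitrary. For $t\in I_0$, $r_0(t)$ denotes the unique $r\in(r_1(t),r_2(t))$ with $\sigma(t,r)=0$. The energy density and pressure of the McVittie spacetime are $$8\pi\mu+\Lambda=3(H^2+Ka^{-2}),\qquad 8\pi P-\Lambda=-\sigma^{-1}\frac{\partial}{\partial t}(H^2+Ka^{-2})-3(H^2+Ka^{-2}).$$ The weak energy condition for a perfect fluid is $\mu\ge0$ and $\mu+P\ge0$.
   Formalization: s_M is assumed C^1 on I_0 (else Σ_0 need not be a hypersurface); as the metric degenerates on Σ_0, "spacelike" is proved modulo its radical, and literally only where r_0'(t)≠0 (it fails e.g. for s_M=0, r_0=3M). *)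

theory Defs
  imports "HOL-Analysis.Analysis"
begin

text \<open>
  McVittie spacetimes over an FLRW background with scale factor \<open>a\<close> and curvature index
  \<open>K = +1\<close>; the index is substituted throughout, so \<open>K a\<^sup>-\<^sup>2\<close> appears as \<open>1 / (a t)\<^sup>2\<close>.
  The argument \<open>sM\<close> stands for the function \<open>s\<^sub>M\<close> of \<open>t\<close> alone.
\<close>

definition hubble :: "(real \<Rightarrow> real) \<Rightarrow> real \<Rightarrow> real" where
  "hubble a t = deriv a t / a t"

definition flrw_density :: "real \<Rightarrow> (real \<Rightarrow> real) \<Rightarrow> real \<Rightarrow> real" where
  "flrw_density \<Lambda> a t = (3 * ((hubble a t)\<^sup>2 + 1 / (a t)\<^sup>2) - \<Lambda>) / (8 * pi)"

definition flrw_pressure :: "real \<Rightarrow> (real \<Rightarrow> real) \<Rightarrow> real \<Rightarrow> real" where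
  "flrw_pressure \<Lambda> a t =
     (\<Lambda> - 2 * deriv (hubble a) t - 3 * (hubble a t)\<^sup>2 - 1 / (a t)\<^sup>2) / (8 * pi)"

definition kappa :: "real \<Rightarrow> (real \<Rightarrow> real) \<Rightarrow> real \<Rightarrow> real \<Rightarrow> real" where
  "kappa M a t r = 1 - 2 * M / r - r\<^sup>2 / (a t)\<^sup>2"

text \<open>The integral is oriented: it changes sign when \<open>r < 3 M\<close>.\<close>

definition sigma :: "real \<Rightarrow> (real \<Rightarrow> real) \<Rightarrow> (real \<Rightarrow> real) \<Rightarrow> real \<Rightarrow> real \<Rightarrow> real" where
  "sigma M a sM t r =
     sM t * kappa M a t r powr (1 / 2) +
     hubble a t / (a t)\<^sup>2 * kappa M a t r powr (1 / 2) *
       (LBINT x = ereal (3 * M)..ereal r. x * kappa M a t x powr (- 3 / 2))"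

definition I0 :: "real \<Rightarrow> real set \<Rightarrow> (real \<Rightarrow> real) \<Rightarrow> real set" where
  "I0 M I a = {t \<in> I. a t > 3 * sqrt 3 * M \<and> hubble a t \<noteq> 0}"

definition allowed_region :: "real \<Rightarrow> real set \<Rightarrow> (real \<Rightarrow> real) \<Rightarrow> (real \<times> real) set" where
  "allowed_region M I a = {(t, r). t \<in> I \<and> 0 < r \<and> 0 < kappa M a t r}"

definition r1 :: "real \<Rightarrow> (real \<Rightarrow> real) \<Rightarrow> real \<Rightarrow> real" where
  "r1 M a t = Min {r. 0 < r \<and> kappa M a t r = 0}"

definition r2 :: "real \<Rightarrow> (real \<Rightarrow> real) \<Rightarrow> real \<Rightarrow> real" where
  "r2 M a t = Max {r. 0 < r \<and> kappa M a t r = 0}"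

definition r0 :: "real \<Rightarrow> (real \<Rightarrow> real) \<Rightarrow> (real \<Rightarrow> real) \<Rightarrow> real \<Rightarrow> real" where
  "r0 M a sM t = (THE r. r1 M a t < r \<and> r < r2 M a t \<and> sigma M a sM t r = 0)"

text \<open>
  Sets of events are given in the \<open>(t, r)\<close> half plane; the spheres of symmetry are suppressed.
\<close>

definition Sigma0 ::
    "real \<Rightarrow> real set \<Rightarrow> (real \<Rightarrow> real) \<Rightarrow> (real \<Rightarrow> real) \<Rightarrow> (real \<times> real) set" where
  "Sigma0 M I a sM = {(t, r). t \<in> I0 M I a \<and> r = r0 M a sM t}"

definition R1 ::
    "real \<Rightarrow> real set \<Rightarrow> (real \<Rightarrow> real) \<Rightarrow> (real \<Rightarrow> real) \<Rightarrow> (real \<times> real) set" where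
  "R1 M I a sM = {(t, r). t \<in> I0 M I a \<and> r1 M a t < r \<and> r < r0 M a sM t}"

definition R2 ::
    "real \<Rightarrow> real set \<Rightarrow> (real \<Rightarrow> real) \<Rightarrow> (real \<Rightarrow> real) \<Rightarrow> (real \<times> real) set" where
  "R2 M I a sM = {(t, r). t \<in> I0 M I a \<and> r0 M a sM t < r \<and> r < r2 M a t}"

definition mcv_density :: "real \<Rightarrow> (real \<Rightarrow> real) \<Rightarrow> real \<Rightarrow> real" where
  "mcv_density \<Lambda> a t = (3 * ((hubble a t)\<^sup>2 + 1 / (a t)\<^sup>2) - \<Lambda>) / (8 * pi)"

text \<open>Only meaningful where \<open>sigma\<close> does not vanish.\<close>

definition mcv_pressure ::
    "real \<Rightarrow> real \<Rightarrow> (real \<Rightarrow> real) \<Rightarrow> (real \<Rightarrow> real) \<Rightarrow> real \<Rightarrow> real \<Rightarrow> real" where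
  "mcv_pressure M \<Lambda> a sM t r =
     (\<Lambda> - inverse (sigma M a sM t r) * deriv (\<lambda>\<tau>. (hubble a \<tau>)\<^sup>2 + 1 / (a \<tau>)\<^sup>2) t
        - 3 * ((hubble a t)\<^sup>2 + 1 / (a t)\<^sup>2)) / (8 * pi)"

definition weak_energy_condition :: "real \<Rightarrow> real \<Rightarrow> bool" where
  "weak_energy_condition \<mu> P \<longleftrightarrow> 0 \<le> \<mu> \<and> 0 \<le> \<mu> + P"

text \<open>
  Events are triples \<open>(t, r, \<omega>)\<close> with \<open>\<omega>\<close> on the unit sphere of \<open>\<real>\<^sup>3\<close>. A tangent
  vector is a triple \<open>(\<tau>, \<rho>, w)\<close> with \<open>w\<close> orthogonal to \<open>\<omega>\<close>, and \<open>d\<omega>\<^sup>2\<close> is the metric induced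
  on the sphere by the inner product of \<open>\<real>\<^sup>3\<close>.
\<close>

type_synonym event = "real \<times> real \<times> (real ^ 3)"

definition spherical_lift :: "(real \<times> real) set \<Rightarrow> event set" where
  "spherical_lift S = {(t, r, \<omega>). (t, r) \<in> S \<and> norm \<omega> = 1}"

definition tangent_space :: "event \<Rightarrow> event set" where
  "tangent_space p = (case p of (t, r, \<omega>) \<Rightarrow> {(\<tau>, \<rho>, w). w \<bullet> \<omega> = 0})"

text \<open>The line element, polarised to a symmetric bilinear form.\<close>

definition mcv_metric ::
    "real \<Rightarrow> (real \<Rightarrow> real) \<Rightarrow> (real \<Rightarrow> real) \<Rightarrow> event \<Rightarrow> event \<Rightarrow> event \<Rightarrow> real" where
  "mcv_metric M a sM p u v =
     (case p of (t, r, \<omega>) \<Rightarrow> case u of (\<tau>, \<rho>, w) \<Rightarrow> case v of (\<tau>', \<rho>', w') \<Rightarrow>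
        - (sigma M a sM t r)\<^sup>2 * (1 / (hubble a t)\<^sup>2 - r\<^sup>2 / kappa M a t r) * \<tau> * \<tau>'
        - sigma M a sM t r * r / kappa M a t r * (\<tau> * \<rho>' + \<tau>' * \<rho>)
        + \<rho> * \<rho>' / kappa M a t r
        + r\<^sup>2 * (w \<bullet> w'))"

definition tangent_vectors :: "'a::real_normed_vector set \<Rightarrow> 'a \<Rightarrow> 'a set" where
  "tangent_vectors S p =
     {v. \<exists>\<gamma>. \<gamma> 0 = p \<and> (\<forall>\<^sub>F x in nhds (0::real). \<gamma> x \<in> S) \<and>
            (\<gamma> has_vector_derivative v) (at 0)}"

definition C1_hypersurface :: "'a::euclidean_space set \<Rightarrow> bool" where
  "C1_hypersurface S \<longleftrightarrow>
     (\<forall>p\<in>S. \<exists>U F G. open U \<and> p \<in> U \<and>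
        (\<forall>x\<in>U. ((F :: 'a \<Rightarrow> real) has_derivative (\<lambda>h. G x \<bullet> h)) (at x) \<and> G x \<noteq> 0) \<and>
        continuous_on U G \<and> S \<inter> U = {x \<in> U. F x = 0})"

text \<open>
  The metric is degenerate wherever \<open>sigma\<close> vanishes: there it reduces to
  \<open>\<kappa>\<^sup>-\<^sup>1 dr\<^sup>2 + r\<^sup>2 d\<omega>\<^sup>2\<close>, with radical spanned by \<open>(1, 0, 0)\<close>. Hence two versions of
  ``spacelike'' at an event: the usual one (the induced metric is positive definite) and the one
  appropriate to a degenerate metric (positive definite modulo the radical). They agree
  wherever the metric is nondegenerate.
\<close>

definition spacelike_at ::
    "(event \<Rightarrow> event \<Rightarrow> event \<Rightarrow> real) \<Rightarrow> event set \<Rightarrow> event \<Rightarrow> bool" where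
  "spacelike_at g S p \<longleftrightarrow> (\<forall>v\<in>tangent_vectors S p. v \<noteq> 0 \<longrightarrow> 0 < g p v v)"

definition radical :: "(event \<Rightarrow> event \<Rightarrow> event \<Rightarrow> real) \<Rightarrow> event \<Rightarrow> event set" where
  "radical g p = {v \<in> tangent_space p. \<forall>u\<in>tangent_space p. g p u v = 0}"

definition spacelike_mod_radical_at ::
    "(event \<Rightarrow> event \<Rightarrow> event \<Rightarrow> real) \<Rightarrow> event set \<Rightarrow> event \<Rightarrow> bool" where
  "spacelike_mod_radical_at g S p \<longleftrightarrow>
     (\<forall>v\<in>tangent_vectors S p. v \<notin> radical g p \<longrightarrow> 0 < g p v v)"

text \<open>The minimum and maximum in \<open>r1\<close> and \<open>r2\<close> are over a set with exactly two elements.\<close>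

lemma kappa_zeros:
  assumes M: "M > 0" and a: "a t > 3 * sqrt 3 * M"
  shows "{r. 0 < r \<and> kappa M a t r = 0} = {r1 M a t, r2 M a t}"
    and "0 < r1 M a t" and "r1 M a t < r2 M a t"
    and "\<And>r. 0 < r \<Longrightarrow> 0 < kappa M a t r \<longleftrightarrow> r1 M a t < r \<and> r < r2 M a t"
proof -
  define A where "A = a t"
  have A0: "A > 0" using M a unfolding A_def
    by (smt (verit) mult_pos_pos real_sqrt_gt_zero)
  have "(3 * sqrt 3 * M)\<^sup>2 < A\<^sup>2"
    using M a A_def by (intro power_strict_mono) auto
  then have A27: "27 * M\<^sup>2 < A\<^sup>2" by (simp add: power_mult_distrib)
  have A3: "3 * M < A"
  proof -
    have "(3 * M)\<^sup>2 < A\<^sup>2" using A27 M by (simp add: power_mult_distrib) (smt (verit) zero_le_power2)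
    from power2_less_imp_less[OF this] show ?thesis using A0 by linarith
  qed
  define f where "f r = A\<^sup>2 * r - 2 * M * A\<^sup>2 - r ^ 3" for r
  have kf: "kappa M a t r = f r / (A\<^sup>2 * r)" if "r > 0" for r
    using that A0 unfolding kappa_def f_def A_def[symmetric]
    by (simp add: field_simps power2_eq_square power3_eq_cube)
  have cont: "continuous_on S f" for S unfolding f_def by (intro continuous_intros)
  have f0: "f 0 < 0" using M A0 by (simp add: f_def)
  have "f (3 * M) = M * (A\<^sup>2 - 27 * M\<^sup>2)"
    by (simp add: f_def algebra_simps power2_eq_square power3_eq_cube)
  then have f3: "f (3 * M) > 0" using M A27 by simp
  have fA: "f A < 0" using M A0 by (simp add: f_def power2_eq_square power3_eq_cube)
  obtain x where x: "0 \<le> x" "x \<le> 3 * M" "f x = 0"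
    using IVT'[of f 0 0 "3 * M"] f0 f3 M cont by (metis less_imp_le mult_pos_pos zero_less_numeral)
  obtain y where y: "3 * M \<le> y" "y \<le> A" "f y = 0"
    using IVT2'[of f A 0 "3 * M"] fA f3 A3 cont by (metis less_imp_le)
  have xy: "0 < x" "x < 3 * M" "3 * M < y"
    using x y f0 f3 by (metis less_irrefl less_le)+
  have "(x - y) * (A\<^sup>2 - (x\<^sup>2 + x * y + y\<^sup>2)) = f x - f y"
    by (simp add: f_def algebra_simps power2_eq_square power3_eq_cube)
  then have AA: "A\<^sup>2 = x\<^sup>2 + x * y + y\<^sup>2" using x y xy by auto
  have fac: "f r = (r - x) * (y - r) * (r + x + y)" for r
  proof -
    have "f r = f r - f x" using x by simp
    also have "\<dots> = A\<^sup>2 * (r - x) - r ^ 3 + x ^ 3" by (simp add: f_def algebra_simps)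
    also have "\<dots> = (r - x) * (y - r) * (r + x + y)"
      unfolding AA by (simp add: algebra_simps power2_eq_square power3_eq_cube)
    finally show ?thesis .
  qed
  have k0: "kappa M a t r = 0 \<longleftrightarrow> r = x \<or> r = y" if "r > 0" for r
    using that A0 xy kf[OF that] fac[of r] by auto
  have Z: "{r. 0 < r \<and> kappa M a t r = 0} = {x, y}"
    using k0 xy M by auto
  have r12: "r1 M a t = x" "r2 M a t = y"
    unfolding r1_def r2_def Z using xy by auto
  show "{r. 0 < r \<and> kappa M a t r = 0} = {r1 M a t, r2 M a t}"
    "0 < r1 M a t" "r1 M a t < r2 M a t"
    using Z r12 xy by auto
  show "0 < kappa M a t r \<longleftrightarrow> r1 M a t < r \<and> r < r2 M a t" if "0 < r" for r
  proof -
    have "0 < kappa M a t r \<longleftrightarrow> 0 < f r"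
      using that A0 kf[OF that] by (simp add: pos_less_divide_eq)
    also have "\<dots> \<longleftrightarrow> 0 < (r - x) * (y - r)"
      unfolding fac using that xy by (simp add: zero_less_mult_iff)
    also have "\<dots> \<longleftrightarrow> x < r \<and> r < y"
      using xy by (auto simp: zero_less_mult_iff)
    finally show ?thesis by (simp add: r12)
  qed
qed

end

theory Submission
  imports Defs
begin

text \<open>
  With \<open>b = 1 / a\<^sup>2\<close>, \<open>J b r\<close> the integral of \<open>x \<kappa> powr (-3/2)\<close> from \<open>3 M\<close> to \<open>r\<close> and
  \<open>F = s\<^sub>M a\<^sup>2 / H + J b r\<close>, one has \<open>\<sigma> = \<surd>\<kappa> (H / a\<^sup>2) F\<close> wherever \<open>\<kappa> > 0\<close>. For fixed \<open>t\<close>,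
  \<open>F\<close> increases strictly from \<open>-\<infinity>\<close> to \<open>\<infinity>\<close> between the zeros of \<open>\<kappa>\<close>, which yields \<open>r\<^sub>0\<close>,
  and the implicit function theorem makes \<open>r\<^sub>0\<close> continuously differentiable.
  Since \<open>(H\<^sup>2 + a\<^sup>-\<^sup>2)' = 2 H (H' - a\<^sup>-\<^sup>2)\<close>, the factor \<open>H\<close> cancels in
  \<open>8 \<pi> (\<mu> + P) = 2 a\<^sup>2 (a\<^sup>-\<^sup>2 - H') / (\<surd>\<kappa> F)\<close>, whose sign is that of \<open>F\<close>: it is negative on all of
  \<open>R1\<close>, whatever the sign of \<open>H\<close> on the components of \<open>I0\<close>.
\<close>

section \<open>Implicit functions of one real variable\<close>

text \<open>The absolute values leave the order of \<open>p\<close> and \<open>q\<close> open: along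
  a graph the second point may lie above, below or at the first one.\<close>

lemma MVT_between:
  fixes f f' :: "real \<Rightarrow> real"
  assumes "\<And>x. \<bar>x - p\<bar> \<le> \<bar>q - p\<bar> \<Longrightarrow> (f has_real_derivative f' x) (at x)"
  obtains \<xi> where "\<bar>\<xi> - p\<bar> \<le> \<bar>q - p\<bar>" "f q - f p = (q - p) * f' \<xi>"
proof (cases p q rule: linorder_cases)
  case less
  then obtain z where "p < z" "z < q" "f q - f p = (q - p) * f' z"
    using MVT2[of p q f f'] assms by auto
  with less show thesis by (intro that[of z]) auto
next
  case equal
  then show thesis by (intro that[of p]) auto
next
  case greater
  then obtain z where z: "q < z" "z < p" "f p - f q = (p - q) * f' z"
    using MVT2[of q p f f'] assms by auto
  then have "f q - f p = (q - p) * f' z" by (simp add: algebra_simps)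
  with z greater show thesis by (intro that[of z]) auto
qed

text \<open>Since \<open>F\<close> increases in \<open>r\<close>, its signs just below and just
  above the graph persist for nearby times; the intermediate value theorem and \<open>uniq\<close>
  then trap \<open>\<phi>\<close> there, which gives continuity. The mean value theorem in
  \<open>r\<close> alone then gives the derivative \<open>- Ft / Fr\<close>, so that partial
  derivatives suffice throughout.\<close>

lemma implicit_function_C1:
  fixes F Ft Fr :: "real \<Rightarrow> real \<Rightarrow> real"
  assumes S: "open S"
    and graph: "\<And>t. t \<in> T \<Longrightarrow> (t, \<phi> t) \<in> S" "\<And>t. t \<in> T \<Longrightarrow> F t (\<phi> t) = 0"
    and T: "open T"
    and uniq: "\<And>t r. (t, r) \<in> S \<Longrightarrow> F t r = 0 \<Longrightarrow> r = \<phi> t"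
    and dt: "\<And>t r. (t, r) \<in> S \<Longrightarrow> ((\<lambda>\<tau>. F \<tau> r) has_real_derivative Ft t r) (at t)"
    and dr: "\<And>t r. (t, r) \<in> S \<Longrightarrow> (F t has_real_derivative Fr t r) (at r)"
    and pos: "\<And>t r. (t, r) \<in> S \<Longrightarrow> Fr t r > 0"
    and ct: "continuous_on S (\<lambda>(t, r). Ft t r)"
    and cr: "continuous_on S (\<lambda>(t, r). Fr t r)"
  shows "\<phi> C1_differentiable_on T"
proof -
  have rect: "\<exists>d>0. ball t d \<times> ball (\<phi> t) d \<subseteq> S" if "t \<in> T" for t
  proof -
    obtain A B where AB: "open A" "open B" "t \<in> A" "\<phi> t \<in> B" "A \<times> B \<subseteq> S"
      using open_prod_elim[OF S graph(1)] \<open>t \<in> T\<close> by (metis mem_Times_iff fst_conv snd_conv)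
    obtain e1 e2 where e: "e1 > 0" "ball t e1 \<subseteq> A" "e2 > 0" "ball (\<phi> t) e2 \<subseteq> B"
      using AB by (meson open_contains_ball)
    have "ball t (min e1 e2) \<times> ball (\<phi> t) (min e1 e2) \<subseteq> S"
      using AB(5) e(2,4) by fastforce
    then show ?thesis using e by (intro exI[of _ "min e1 e2"]) auto
  qed
  have cont: "(\<phi> \<longlongrightarrow> \<phi> t) (at t)" if t: "t \<in> T" for t
  proof (rule tendstoI)
    fix e :: real assume "e > 0"
    obtain d where d: "d > 0" "ball t d \<times> ball (\<phi> t) d \<subseteq> S" using rect[OF t] by blast
    \<comment> \<open>Halving makes \<open>h\<close> smaller than \<open>d\<close>, so the closed
      strip of half-width \<open>h\<close> stays in the rectangle, and smaller than
      \<open>e\<close>, so a root in the strip is strictly within \<open>e\<close>.\<close>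
    define h where "h = min (d / 2) (e / 2)"
    have h: "h > 0" "h < d" "h < e" using d \<open>e > 0\<close> by (auto simp: h_def min_def)
    have inS: "(\<tau>, r) \<in> S" if "dist t \<tau> < d" "\<phi> t - h \<le> r" "r \<le> \<phi> t + h" for \<tau> r
      using d h that by (intro subsetD[OF d(2)]) (auto simp: dist_real_def)
    have mono: "F \<tau> x < F \<tau> y" if "dist t \<tau> < d" "\<phi> t - h \<le> x" "x < y" "y \<le> \<phi> t + h" for \<tau> x y
      by (rule DERIV_pos_imp_increasing[OF \<open>x < y\<close>])
        (use that in \<open>force intro!: dr pos inS\<close>)
    have "F t (\<phi> t - h) < 0" "F t (\<phi> t + h) > 0"
      using mono[of t "\<phi> t - h" "\<phi> t"] mono[of t "\<phi> t" "\<phi> t + h"] h d graph(2)[OF t] by auto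
    moreover have "((\<lambda>\<tau>. F \<tau> r) \<longlongrightarrow> F t r) (at t)" if "\<phi> t - h \<le> r" "r \<le> \<phi> t + h" for r
      using DERIV_isCont[OF dt[OF inS]] that d by (simp add: isCont_def)
    ultimately have "\<forall>\<^sub>F \<tau> in at t. F \<tau> (\<phi> t - h) < 0" "\<forall>\<^sub>F \<tau> in at t. F \<tau> (\<phi> t + h) > 0"
      using h by (auto intro!: order_tendstoD)
    moreover have "\<forall>\<^sub>F \<tau> in at t. dist t \<tau> < d"
      using d by (auto simp: eventually_at dist_commute)
    ultimately show "\<forall>\<^sub>F \<tau> in at t. dist (\<phi> \<tau>) (\<phi> t) < e"
    proof eventually_elim
      case (elim \<tau>)
      have "continuous_on {\<phi> t - h..\<phi> t + h} (F \<tau>)"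
        using elim by (intro continuous_at_imp_continuous_on ballI DERIV_isCont[OF dr] inS) auto
      then obtain r where r: "\<phi> t - h \<le> r" "r \<le> \<phi> t + h" "F \<tau> r = 0"
        using IVT'[of "F \<tau>" "\<phi> t - h" 0 "\<phi> t + h"] elim h by auto
      then have "r = \<phi> \<tau>" using uniq inS elim by blast
      then show ?case using r h by (auto simp: dist_real_def)
    qed
  qed
  define D where "D t = - Ft t (\<phi> t) / Fr t (\<phi> t)" for t
  have deriv: "(\<phi> has_real_derivative D t) (at t)" if t: "t \<in> T" for t
  proof -
    obtain d where d: "d > 0" "ball t d \<times> ball (\<phi> t) d \<subseteq> S" using rect[OF t] by blast
    have inS: "(\<tau>, r) \<in> S" if "dist \<tau> t < d" "\<bar>r - \<phi> t\<bar> < d" for \<tau> r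
      using d that by (intro subsetD[OF d(2)]) (auto simp: dist_real_def)
    have near: "\<forall>\<^sub>F \<tau> in at t. dist \<tau> t < d \<and> dist (\<phi> \<tau>) (\<phi> t) < d \<and> \<tau> \<in> T \<and> \<tau> \<noteq> t"
      using d by (intro eventually_conj tendstoD[OF cont[OF t]] topological_tendstoD[OF tendsto_ident_at T t])
        (auto simp: eventually_at intro: exI[of _ d] topological_tendstoD[OF tendsto_ident_at T t])
    \<comment> \<open>The mean value point has to be a function of \<open>\<tau>\<close> for its
      limit to make sense; the bound on its distance from \<open>\<phi> t\<close> squeezes it to
      \<open>\<phi> t\<close>.\<close>
    define \<xi> where "\<xi> \<tau> = (SOME z. \<bar>z - \<phi> t\<bar> \<le> \<bar>\<phi> \<tau> - \<phi> t\<bar> \<and>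
        F \<tau> (\<phi> \<tau>) - F \<tau> (\<phi> t) = (\<phi> \<tau> - \<phi> t) * Fr \<tau> z)" for \<tau>
    have \<xi>: "\<bar>\<xi> \<tau> - \<phi> t\<bar> \<le> \<bar>\<phi> \<tau> - \<phi> t\<bar> \<and>
        F \<tau> (\<phi> \<tau>) - F \<tau> (\<phi> t) = (\<phi> \<tau> - \<phi> t) * Fr \<tau> (\<xi> \<tau>)"
      if "dist \<tau> t < d" "dist (\<phi> \<tau>) (\<phi> t) < d" for \<tau>
      unfolding \<xi>_def
    proof (rule someI_ex)
      have "(F \<tau> has_real_derivative Fr \<tau> x) (at x)" if "\<bar>x - \<phi> t\<bar> \<le> \<bar>\<phi> \<tau> - \<phi> t\<bar>" for x
        using that \<open>dist \<tau> t < d\<close> \<open>dist (\<phi> \<tau>) (\<phi> t) < d\<close>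
        by (intro dr inS) (auto simp: dist_real_def)
      from MVT_between[OF this]
      show "\<exists>z. \<bar>z - \<phi> t\<bar> \<le> \<bar>\<phi> \<tau> - \<phi> t\<bar> \<and>
        F \<tau> (\<phi> \<tau>) - F \<tau> (\<phi> t) = (\<phi> \<tau> - \<phi> t) * Fr \<tau> z" by metis
    qed
    have "(\<xi> \<longlongrightarrow> \<phi> t) (at t)"
    proof (rule Lim_transform_bound[where g = "\<lambda>\<tau>. \<phi> \<tau> - \<phi> t", THEN LIM_zero_cancel])
      show "\<forall>\<^sub>F \<tau> in at t. norm (\<xi> \<tau> - \<phi> t) \<le> norm (\<phi> \<tau> - \<phi> t)"
        using near by eventually_elim (use \<xi> in auto)
      show "((\<lambda>\<tau>. \<phi> \<tau> - \<phi> t) \<longlongrightarrow> 0) (at t)" by (rule LIM_zero[OF cont[OF t]])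
    qed
    then have lim: "((\<lambda>\<tau>. (\<tau>, \<xi> \<tau>)) \<longlongrightarrow> (t, \<phi> t)) (at t)" by (intro tendsto_intros)
    have "((\<lambda>p. case p of (t, r) \<Rightarrow> Fr t r) \<longlongrightarrow> Fr t (\<phi> t)) (at (t, \<phi> t))"
      using cr S graph(1)[OF t] by (auto simp: continuous_on_eq_continuous_at isCont_def)
    then have Frlim: "((\<lambda>\<tau>. Fr \<tau> (\<xi> \<tau>)) \<longlongrightarrow> Fr t (\<phi> t)) (at t)"
      using isCont_tendsto_compose[OF _ lim, of "\<lambda>(t, r). Fr t r"] by (simp add: isCont_def)
    \<comment> \<open>As \<open>F\<close> vanishes on the graph, the mean value identity reads
      \<open>(\<phi> \<tau> - \<phi> t) * Fr \<tau> (\<xi> \<tau>) = - (F \<tau> (\<phi> t) - F t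
      (\<phi> t))\<close>; dividing by \<open>\<tau> - t\<close> expresses the difference quotient
      of \<open>\<phi>\<close> through that of \<open>F\<close> in time.\<close>
    have "((\<lambda>\<tau>. - ((F \<tau> (\<phi> t) - F t (\<phi> t)) / (\<tau> - t)) / Fr \<tau> (\<xi> \<tau>)) \<longlongrightarrow> D t) (at t)"
      unfolding D_def using dt[OF graph(1)[OF t]] pos[OF graph(1)[OF t]] Frlim
      by (intro tendsto_intros) (auto simp: has_field_derivative_iff)
    moreover have "\<forall>\<^sub>F \<tau> in at t. - ((F \<tau> (\<phi> t) - F t (\<phi> t)) / (\<tau> - t)) / Fr \<tau> (\<xi> \<tau>)
        = (\<phi> \<tau> - \<phi> t) / (\<tau> - t)"
      using near
    proof eventually_elim
      case (elim \<tau>)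
      note z = \<xi>[of \<tau>]
      have "Fr \<tau> (\<xi> \<tau>) > 0" using elim z by (intro pos inS) (auto simp: dist_real_def)
      then show ?case using elim z graph(2)[of \<tau>] graph(2)[OF t] by (simp add: field_simps)
    qed
    ultimately show ?thesis
      unfolding has_field_derivative_iff by (rule Lim_transform_eventually)
  qed
  have "continuous_on T \<phi>"
    using deriv by (intro continuous_at_imp_continuous_on ballI) (blast intro: DERIV_isCont)
  then have pair: "continuous_on T (\<lambda>t. (t, \<phi> t))" by (intro continuous_intros)
  have "continuous_on T D"
    unfolding D_def
    using continuous_on_compose2[OF ct pair] continuous_on_compose2[OF cr pair] graph(1) pos
    by (intro continuous_intros) (auto simp: image_subset_iff less_imp_neq[THEN not_sym])
  with deriv show ?thesis
    unfolding C1_differentiable_on_def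
    by (auto intro!: exI[of _ D] simp: has_real_derivative_iff_has_vector_derivative)
qed

section \<open>The radial integral as a function of two real variables\<close>

text \<open>Time enters \<open>kappa\<close> only through \<open>1 / (a t)\<^sup>2\<close>. Making
  this the parameter \<open>b\<close> separates the analysis of the integral from the scale
  factor.\<close>

definition lapse :: "real \<Rightarrow> real \<Rightarrow> real \<Rightarrow> real" where
  "lapse M b r = 1 - 2 * M / r - b * r\<^sup>2"

lemma kappa_eq_lapse: "kappa M a t r = lapse M (1 / (a t)\<^sup>2) r"
  by (simp add: kappa_def lapse_def)

text \<open>Positivity is required at both ends of the integration path, \<open>3 * M\<close> and
  \<open>r\<close>; by \<open>lapse_pos_between\<close> it then holds along the whole path.\<close>

definition lapse_dom :: "real \<Rightarrow> (real \<times> real) set" where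
  "lapse_dom M = {(b, r). 0 < b \<and> 0 < r \<and> 0 < lapse M b (3 * M) \<and> 0 < lapse M b r}"

definition radial_int :: "real \<Rightarrow> real \<Rightarrow> real \<Rightarrow> real" where
  "radial_int M b r = (LBINT x = ereal (3 * M)..ereal r. x * lapse M b x powr (- 3 / 2))"

text \<open>Rescaling the integral to \<open>{0..1}\<close> removes both the variable endpoint and the case distinction
  \<open>r < 3 M\<close>, so that the theorems on parameter integrals apply.\<close>

definition ray :: "real \<Rightarrow> real \<Rightarrow> real \<Rightarrow> real" where
  "ray M r u = 3 * M + u * (r - 3 * M)"

text \<open>This is the derivative of \<open>radial_int\<close> in \<open>b\<close>: differentiating
  the power brings down \<open>3 / 2\<close> and a factor \<open>x\<^sup>2\<close>, which makes a
  cube with the \<open>x\<close> of the integrand. The factor \<open>r - 3 * M\<close> is the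
  Jacobian of \<open>ray\<close>.\<close>

definition radial_int_deriv :: "real \<Rightarrow> real \<Rightarrow> real \<Rightarrow> real" where
  "radial_int_deriv M b r = integral (cbox 0 1)
     (\<lambda>u. (r - 3 * M) * (3 / 2 * ray M r u ^ 3 * lapse M b (ray M r u) powr (- 5 / 2)))"

lemma lapse_pos_iff: "0 < r \<Longrightarrow> 0 < lapse M b r \<longleftrightarrow> 0 < r - 2 * M - b * r ^ 3"
proof -
  assume r: "0 < r"
  have "r - 2 * M - b * r ^ 3 = r * lapse M b r"
    using r by (simp add: lapse_def field_simps power2_eq_square power3_eq_cube)
  then show ?thesis using r by (simp add: zero_less_mult_iff)
qed

text \<open>On positive \<open>r\<close> the cubic \<open>r - 2 * M - b * r ^ 3\<close> is concave,
  so it lies above its chords; the identity in the proof writes out the excess over the chord as a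
  product of nonnegative factors.\<close>

lemma lapse_pos_between:
  assumes "0 \<le> b" "0 < p" "p \<le> x" "x \<le> q" "0 < lapse M b p" "0 < lapse M b q"
  shows "0 < lapse M b x"
proof (cases "p = q")
  case False
  define h where "h r = r - 2 * M - b * r ^ 3" for r
  have h: "h p > 0" "h q > 0" using assms lapse_pos_iff[of p M b] lapse_pos_iff[of q M b] by (auto simp: h_def)
  have "(q - p) * h x =
      (q - x) * h p + (x - p) * h q + b * (x - p) * (q - x) * (q - p) * (p + x + q)"
    by (simp add: h_def algebra_simps power3_eq_cube)
  moreover have "(q - x) * h p + (x - p) * h q > 0"
  proof (cases "x = p")
    case True
    then show ?thesis using h assms False by auto
  next
    case False
    then show ?thesis using h assms by (intro add_nonneg_pos) auto
  qed
  moreover have "b * (x - p) * (q - x) * (q - p) * (p + x + q) \<ge> 0"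
    using assms by (intro mult_nonneg_nonneg) auto
  ultimately have "(q - p) * h x > 0" by linarith
  then have "h x > 0" using assms by (auto simp: zero_less_mult_iff)
  then show ?thesis using assms by (auto simp: h_def lapse_pos_iff)
qed (use assms in auto)

lemma lapse_domD:
  assumes "0 < M" "(b, r) \<in> lapse_dom M" "min (3 * M) r \<le> x" "x \<le> max (3 * M) r"
  shows "0 < x" "0 < lapse M b x"
proof -
  show "0 < x" using assms by (auto simp: lapse_dom_def)
  show "0 < lapse M b x"
    using assms by (intro lapse_pos_between[of b "min (3 * M) r" x "max (3 * M) r"])
      (auto simp: lapse_dom_def min_def max_def split: if_splits)
qed

lemma ray_domD:
  assumes "0 < M" "(b, r) \<in> lapse_dom M" "u \<in> {0..1}"
  shows "0 < ray M r u" "0 < lapse M b (ray M r u)"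
proof -
  have "min (3 * M) r \<le> ray M r u \<and> ray M r u \<le> max (3 * M) r"
  proof (cases "3 * M \<le> r")
    case True
    have "u * (r - 3 * M) \<le> 1 * (r - 3 * M)" using True assms by (intro mult_right_mono) auto
    moreover have "0 \<le> u * (r - 3 * M)" using True assms by auto
    ultimately show ?thesis by (simp add: ray_def min_def max_def)
  next
    case False
    have "u * (3 * M - r) \<le> 1 * (3 * M - r)" using False assms by (intro mult_right_mono) auto
    moreover have "0 \<le> u * (3 * M - r)" using False assms by auto
    ultimately show ?thesis using False by (simp add: ray_def min_def max_def algebra_simps)
  qed
  then show "0 < ray M r u" "0 < lapse M b (ray M r u)"
    using lapse_domD[OF assms(1,2)] by auto
qed

lemma continuous_on_lapse [continuous_intros]:
  assumes "continuous_on S f" "continuous_on S g" "\<And>z. z \<in> S \<Longrightarrow> g z \<noteq> 0"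
  shows "continuous_on S (\<lambda>z. lapse M (f z) (g z))"
  unfolding lapse_def using assms by (intro continuous_intros) auto

lemma open_lapse_dom:
  assumes "0 < M" shows "open (lapse_dom M)"
proof -
  have "lapse_dom M = {p. 0 < fst p \<and> 0 < snd p \<and> 0 < lapse M (fst p) (3 * M) \<and>
      0 < snd p - 2 * M - fst p * snd p ^ 3}"
    by (auto simp: lapse_dom_def lapse_pos_iff)
  moreover have "open \<dots>"
    using assms by (intro open_Collect_conj open_Collect_less continuous_intros) auto
  ultimately show ?thesis by simp
qed

text \<open>The free \<open>c\<close>, \<open>k\<close> and \<open>p\<close> let one statement serve
  the integrand (1, 1, -3/2) and its derivative in \<open>b\<close> (3/2, 3, -5/2).\<close>

lemma continuous_on_radial_integrand:
  assumes "0 < M"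
  shows "continuous_on (lapse_dom M \<times> cbox 0 1)
    (\<lambda>((b, r), u). (r - 3 * M) * (c * ray M r u ^ k * lapse M b (ray M r u) powr p))"
proof -
  have "ray M r u \<noteq> 0" "lapse M b (ray M r u) \<noteq> 0" if "(b, r) \<in> lapse_dom M" "u \<in> {0..1}" for b r u
    using ray_domD[OF assms that] by auto
  then show ?thesis
    unfolding case_prod_beta ray_def
    by (intro continuous_intros) (auto intro!: continuous_intros)
qed

text \<open>This is the substitution \<open>x = ray M r u\<close>, valid for either order of
  \<open>3 * M\<close> and \<open>r\<close> because the integral is oriented. The trivial factor and
  exponent 1 keep the shape of \<open>continuous_on_radial_integrand\<close>.\<close>

lemma radial_int_eq:
  assumes M: "0 < M" and br: "(b, r) \<in> lapse_dom M"
  shows "radial_int M b r = integral (cbox 0 1)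
    (\<lambda>u. (r - 3 * M) * (1 * ray M r u ^ 1 * lapse M b (ray M r u) powr (- 3 / 2)))"
proof -
  have nz: "ray M r u \<noteq> 0" "lapse M b (ray M r u) \<noteq> 0" if "u \<in> {0..1}" for u
    using ray_domD[OF M br that] by simp_all
  have "(LBINT u = ereal 0..ereal 1. (r - 3 * M) *\<^sub>R
      (ray M r u * lapse M b (ray M r u) powr (- 3 / 2))) =
      (LBINT x = ereal (ray M r 0)..ereal (ray M r 1). x * lapse M b x powr (- 3 / 2))"
  proof (rule interval_integral_substitution_finite)
    show "(ray M r has_real_derivative r - 3 * M) (at u within {0..1})" for u
      unfolding ray_def by (auto intro!: derivative_eq_intros)
    show "continuous_on (ray M r ` {0..1}) (\<lambda>x. x * lapse M b x powr (- 3 / 2))"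
      by (intro continuous_intros) (auto simp: nz)
  qed auto
  then have "radial_int M b r = (LBINT u = ereal 0..ereal 1. (r - 3 * M) *\<^sub>R
      (ray M r u * lapse M b (ray M r u) powr (- 3 / 2)))"
    by (simp add: radial_int_def ray_def)
  also have "\<dots> = integral {0..1} (\<lambda>u. (r - 3 * M) *\<^sub>R
      (ray M r u * lapse M b (ray M r u) powr (- 3 / 2)))"
  proof (rule interval_integral_eq_integral)
    have ray: "continuous_on {0..1} (ray M r)"
      unfolding ray_def[abs_def] by (intro continuous_intros)
    show "set_integrable lborel {0..1} (\<lambda>u. (r - 3 * M) *\<^sub>R
      (ray M r u * lapse M b (ray M r u) powr (- 3 / 2)))"
      by (intro borel_integrable_atLeastAtMost' continuous_intros ray) (simp_all add: nz)
  qed simp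
  finally show ?thesis by simp
qed

lemma continuous_on_radial_int:
  assumes "0 < M"
  shows "continuous_on (lapse_dom M) (\<lambda>(b, r). radial_int M b r)"
proof -
  have "continuous_on (lapse_dom M) (\<lambda>p. integral (cbox 0 1) (\<lambda>u. case p of (b, r) \<Rightarrow>
      (r - 3 * M) * (1 * ray M r u ^ 1 * lapse M b (ray M r u) powr (- 3 / 2))))"
    by (rule integral_continuous_on_param)
      (use continuous_on_radial_integrand[OF assms, of 1 1 "- 3 / 2"] in \<open>simp add: case_prod_unfold\<close>)
  then show ?thesis
    by (rule continuous_on_eq) (auto simp: radial_int_eq[OF assms])
qed

lemma continuous_on_radial_int_deriv:
  assumes "0 < M"
  shows "continuous_on (lapse_dom M) (\<lambda>(b, r). radial_int_deriv M b r)"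
proof -
  have "continuous_on (lapse_dom M) (\<lambda>p. integral (cbox 0 1) (\<lambda>u. case p of (b, r) \<Rightarrow>
      (r - 3 * M) * (3 / 2 * ray M r u ^ 3 * lapse M b (ray M r u) powr (- 5 / 2))))"
    by (rule integral_continuous_on_param)
      (use continuous_on_radial_integrand[OF assms, of "3 / 2" 3 "- 5 / 2"] in \<open>simp add: case_prod_unfold\<close>)
  then show ?thesis
    by (rule continuous_on_eq) (auto simp: radial_int_deriv_def)
qed

lemma radial_int_has_derivative_param:
  assumes M: "0 < M" and br: "(b, r) \<in> lapse_dom M"
  shows "((\<lambda>b. radial_int M b r) has_real_derivative radial_int_deriv M b r) (at b)"
proof -
  define U where "U = {b. (b, r) \<in> lapse_dom M}"
  have r: "0 < r" using br by (auto simp: lapse_dom_def)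
  have U: "open U"
  proof -
    have "U = (\<lambda>b. (b, r)) -` lapse_dom M" by (auto simp: U_def)
    then show ?thesis by (simp add: open_vimage open_lapse_dom[OF M] continuous_intros)
  qed
  \<comment> \<open>Lowering \<open>b\<close> raises the lapse, so positivity at the larger of two
    parameters passes to everything between them. Hence \<open>U\<close> is an interval, as the
    convexity condition of the Leibniz rule demands.\<close>
  have anti: "lapse M b2 x \<le> lapse M b1 x" if "b1 \<le> b2" for b1 b2 x
    using that by (simp add: lapse_def mult_right_mono)
  have "is_interval U"
    unfolding is_interval_1
  proof (intro ballI allI impI)
    fix b1 b2 x assume "b1 \<in> U" "b2 \<in> U" "b1 \<le> x \<and> x \<le> b2"
    with anti[of x b2 r] anti[of x b2 "3 * M"] show "x \<in> U"
      by (simp add: U_def lapse_dom_def)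
  qed
  then have "convex U" by (simp add: is_interval_convex_1)
  have bU: "b \<in> U" using br by (simp add: U_def)
  have nz: "ray M r u \<noteq> 0" "lapse M b (ray M r u) \<noteq> 0" if "b \<in> U" "u \<in> cbox 0 1" for b u
    using ray_domD[OF M, of b r u] that by (simp_all add: U_def)
  have lapse_b: "((\<lambda>b. lapse M b x) has_real_derivative - x\<^sup>2) (at b)" for b x
    unfolding lapse_def by (auto intro!: derivative_eq_intros)
  have "((\<lambda>b. integral (cbox 0 1)
      (\<lambda>u. (r - 3 * M) * (1 * ray M r u ^ 1 * lapse M b (ray M r u) powr (- 3 / 2))))
    has_real_derivative radial_int_deriv M b r) (at b within U)"
    unfolding radial_int_deriv_def
  proof (rule leibniz_rule_field_derivative[OF _ _ _ bU \<open>convex U\<close>])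
    fix b' u :: real assume b': "b' \<in> U" and u: "u \<in> cbox 0 1"
    have pos: "0 < lapse M b' (ray M r u)" using ray_domD(2)[OF M] b' u by (simp add: U_def)
    have "((\<lambda>b. (r - 3 * M) * (1 * ray M r u ^ 1 * lapse M b (ray M r u) powr (- 3 / 2)))
       has_real_derivative (r - 3 * M) * (1 * ray M r u ^ 1 *
         (- 3 / 2 * lapse M b' (ray M r u) powr (- 3 / 2 - of_nat 1) * - (ray M r u)\<^sup>2))) (at b')"
      by (intro DERIV_cmult DERIV_fun_powr lapse_b pos)
    also have "(r - 3 * M) * (1 * ray M r u ^ 1 *
         (- 3 / 2 * lapse M b' (ray M r u) powr (- 3 / 2 - of_nat 1) * - (ray M r u)\<^sup>2)) =
      (r - 3 * M) * (3 / 2 * ray M r u ^ 3 * lapse M b' (ray M r u) powr (- 5 / 2))"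
      by (simp add: power2_eq_square power3_eq_cube)
    finally show "((\<lambda>b. (r - 3 * M) * (1 * ray M r u ^ 1 * lapse M b (ray M r u) powr (- 3 / 2)))
       has_real_derivative (r - 3 * M) * (3 / 2 * ray M r u ^ 3 * lapse M b' (ray M r u) powr (- 5 / 2)))
          (at b' within U)"
      by (rule has_field_derivative_at_within)
  next
    fix b' assume b': "b' \<in> U"
    have "continuous_on (cbox 0 1)
      (\<lambda>u. (r - 3 * M) * (1 * ray M r u ^ 1 * lapse M b' (ray M r u) powr (- 3 / 2)))"
      using nz[OF b'] unfolding ray_def by (intro continuous_intros) auto
    then show "(\<lambda>u. (r - 3 * M) * (1 * ray M r u ^ 1 * lapse M b' (ray M r u) powr (- 3 / 2)))
      integrable_on cbox 0 1" by (rule integrable_continuous)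
  next
    show "continuous_on (U \<times> cbox 0 1)
      (\<lambda>(b, u). (r - 3 * M) * (3 / 2 * ray M r u ^ 3 * lapse M b (ray M r u) powr (- 5 / 2)))"
      unfolding case_prod_beta
      using nz unfolding ray_def by (intro continuous_intros) auto
  qed
  then have "((\<lambda>b. radial_int M b r) has_real_derivative radial_int_deriv M b r) (at b within U)"
    by (rule has_field_derivative_transform_within[OF _ zero_less_one bU]) (auto simp: U_def radial_int_eq[OF M])
  then show ?thesis by (simp only: at_within_open[OF bU U])
qed

lemma radial_int_has_derivative:
  assumes M: "0 < M" and br: "(b, r) \<in> lapse_dom M"
  shows "(radial_int M b has_real_derivative r * lapse M b r powr (- 3 / 2)) (at r)"
proof -
  have "open ((\<lambda>r. (b, r)) -` lapse_dom M)"
    by (intro open_vimage open_lapse_dom[OF M] continuous_intros)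
  then obtain e where e: "e > 0" "cball r e \<subseteq> (\<lambda>r. (b, r)) -` lapse_dom M"
    using br unfolding open_contains_cball by blast
  have in_dom: "(b, x) \<in> lapse_dom M" if "r - e \<le> x" "x \<le> r + e" for x
  proof -
    have "x \<in> cball r e" using that by (simp add: dist_real_def abs_le_iff)
    then show ?thesis using e(2) by blast
  qed
  \<comment> \<open>The interval must contain the base point \<open>3 * M\<close> and have
    \<open>r\<close> in its interior, so that the derivative within the interval is two-sided. Its
    points left of \<open>3 * M\<close> are covered by the path to \<open>r - e\<close>, those to
    the right by the path to \<open>r + e\<close>.\<close>
  define p where "p = min (3 * M) (r - e)"
  define q where "q = max (3 * M) (r + e)"
  have pq: "p \<le> 3 * M" "3 * M \<le> q" "p < r" "r < q"
    using e(1) by (simp_all add: p_def q_def)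
  have pos: "0 < x \<and> 0 < lapse M b x" if "p \<le> x" "x \<le> q" for x
  proof (cases "x \<le> 3 * M")
    case True
    then have "min (3 * M) (r - e) \<le> x" "x \<le> max (3 * M) (r - e)"
      using that by (simp_all add: p_def le_max_iff_disj)
    then show ?thesis using lapse_domD[OF M in_dom[of "r - e"]] e(1) by simp
  next
    case False
    then have "min (3 * M) (r + e) \<le> x" "x \<le> max (3 * M) (r + e)"
      using that by (simp_all add: q_def min_le_iff_disj)
    then show ?thesis using lapse_domD[OF M in_dom[of "r + e"]] e(1) by simp
  qed
  have nz: "x \<noteq> 0" "lapse M b x \<noteq> 0" if "x \<in> {p..q}" for x
    using that pos[of x] by auto
  have "continuous_on {p..q} (\<lambda>x. x * lapse M b x powr (- 3 / 2))"
    by (intro continuous_intros) (simp_all add: nz)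
  then have "((\<lambda>u. LBINT y = 3 * M..u. y * lapse M b y powr (- 3 / 2)) has_vector_derivative
      r * lapse M b r powr (- 3 / 2)) (at r within {p..q})"
    using pq by (intro interval_integral_FTC2) simp_all
  moreover have "r \<in> interior {p..q}" using pq by simp
  ultimately have "(radial_int M b has_vector_derivative r * lapse M b r powr (- 3 / 2)) (at r)"
    unfolding radial_int_def[abs_def] by (simp only: at_within_interior)
  then show ?thesis by (simp only: has_real_derivative_iff_has_vector_derivative)
qed

section \<open>Monotonicity and divergence of the radial integral\<close>

lemma radial_int_strict_mono:
  assumes M: "0 < M" and p: "(b, p) \<in> lapse_dom M" and q: "(b, q) \<in> lapse_dom M" and "p < q"
  shows "radial_int M b p < radial_int M b q"
proof (rule DERIV_pos_imp_increasing[OF \<open>p < q\<close>])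
  fix x assume x: "p \<le> x" "x \<le> q"
  then have "0 < lapse M b x"
    using p q by (intro lapse_pos_between[of b p x q]) (auto simp: lapse_dom_def)
  then have "(b, x) \<in> lapse_dom M" using p x by (auto simp: lapse_dom_def)
  then have "(radial_int M b has_real_derivative x * lapse M b x powr (- 3 / 2)) (at x)"
    "0 < x * lapse M b x powr (- 3 / 2)"
    using radial_int_has_derivative[OF M] by (auto simp: lapse_dom_def)
  then show "\<exists>y. (radial_int M b has_real_derivative y) (at x) \<and> 0 < y" by blast
qed

text \<open>The function \<open>\<kappa>\<close> is Lipschitz between its zeros, so the integrand \<open>x \<kappa> powr (-3/2)\<close> dominates a
  multiple of the derivative of \<open>\<kappa> powr (-1/2)\<close>; this forces the integral to diverge at both ends.\<close>

lemma radial_int_comparison: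
  assumes M: "0 < M" and b: "0 < b" and "0 < x1" "3 * M \<in> {x1<..<x2}"
    and pos: "\<And>x. x1 < x \<Longrightarrow> x < x2 \<Longrightarrow> 0 < lapse M b x"
  obtains k where "k > 0"
    "\<And>p q e. x1 < p \<Longrightarrow> p \<le> q \<Longrightarrow> q < x2 \<Longrightarrow> \<bar>e\<bar> = 1 \<Longrightarrow>
      radial_int M b p + e * k * lapse M b p powr (- 1 / 2)
        \<le> radial_int M b q + e * k * lapse M b q powr (- 1 / 2)"
proof
  \<comment> \<open>\<open>C\<close> bounds the derivative of the lapse between \<open>x1\<close>
    and \<open>x2\<close>, and \<open>k\<close> is chosen so that \<open>k / 2 * C = x1\<close>; the
    correction term can then never outweigh the integrand. The sign \<open>e = 1\<close> serves the
    lower zero, \<open>e = -1\<close> the upper one.\<close>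
  define C where "C = 2 * M / x1\<^sup>2 + 2 * b * x2"
  have C: "C > 0" using assms by (auto simp: C_def intro!: add_pos_pos)
  define k where "k = 2 * x1 / C"
  show k: "k > 0" using C assms by (simp add: k_def)
  fix p q e :: real assume pq: "x1 < p" "p \<le> q" "q < x2" and e: "\<bar>e\<bar> = 1"
  show "radial_int M b p + e * k * lapse M b p powr (- 1 / 2)
        \<le> radial_int M b q + e * k * lapse M b q powr (- 1 / 2)"
  proof (rule DERIV_nonneg_imp_nondecreasing[OF \<open>p \<le> q\<close>])
    fix x assume "p \<le> x" "x \<le> q"
    then have x: "x1 < x" "x < x2" using pq by auto
    have "0 < x" using x assms by linarith
    have L: "0 < lapse M b x" using pos x by auto
    have dom: "(b, x) \<in> lapse_dom M" using L x assms by (auto simp: lapse_dom_def)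
    define l' where "l' = 2 * M / x\<^sup>2 - 2 * b * x"
    have "(lapse M b has_real_derivative l') (at x)"
      unfolding lapse_def l'_def using \<open>0 < x\<close>
      by (auto intro!: derivative_eq_intros simp: power2_eq_square)
    from DERIV_fun_powr[OF this L, of "- 1 / 2"]
    have "((\<lambda>x. lapse M b x powr (- 1 / 2)) has_real_derivative
        - 1 / 2 * l' * lapse M b x powr (- 3 / 2)) (at x)"
      by (simp add: mult_ac)
    from DERIV_add[OF radial_int_has_derivative[OF M dom] DERIV_cmult[OF this, of "e * k"]]
    have "((\<lambda>x. radial_int M b x + e * k * lapse M b x powr (- 1 / 2)) has_real_derivative
      (x - e * (k / 2 * l')) * lapse M b x powr (- 3 / 2)) (at x)"
      by (simp add: algebra_simps)
    moreover have "\<bar>k / 2 * l'\<bar> \<le> x"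
    proof -
      have "0 \<le> 2 * M / x\<^sup>2" "2 * M / x\<^sup>2 \<le> 2 * M / x1\<^sup>2"
        using M x assms by (auto intro!: divide_left_mono power_mono mult_pos_pos)
      moreover have "0 \<le> 2 * b * x" "2 * b * x \<le> 2 * b * x2"
        using b x \<open>0 < x\<close> by auto
      ultimately have "\<bar>l'\<bar> \<le> C" unfolding l'_def C_def by linarith
      then have "k / 2 * \<bar>l'\<bar> \<le> k / 2 * C" using k by (intro mult_left_mono) auto
      also have "\<dots> = x1" using C by (simp add: k_def)
      finally show ?thesis using x k by (simp add: abs_mult)
    qed
    then have "e * (k / 2 * l') \<le> x" using e by (auto simp: abs_if split: if_splits)
    ultimately show "\<exists>y. ((\<lambda>x. radial_int M b x + e * k * lapse M b x powr (- 1 / 2))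
        has_real_derivative y) (at x) \<and> 0 \<le> y"
      by (intro exI conjI) auto
  qed
qed

text \<open>The intermediate value theorem is applied to the lapse and the value
  \<open>N powr (- 2)\<close>, not to the negative power itself: \<open>0 powr x\<close> is 0 by
  convention, so that power is discontinuous at the zeros.\<close>

lemma lapse_attains:
  assumes M: "0 < M" and "0 < x1" and 3: "3 * M \<in> {x1<..<x2}"
    and z: "lapse M b x1 = 0" "lapse M b x2 = 0"
    and N: "lapse M b (3 * M) powr (- 1 / 2) \<le> N" "0 < lapse M b (3 * M)"
  shows "\<exists>r. x1 < r \<and> r \<le> 3 * M \<and> lapse M b r powr (- 1 / 2) = N"
    and "\<exists>r. 3 * M \<le> r \<and> r < x2 \<and> lapse M b r powr (- 1 / 2) = N"
proof -
  define y where "y = N powr (- 2)"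
  have "N > 0" using N by (smt (verit) powr_gt_zero)
  have y: "0 < y" "y powr (- 1 / 2) = N" using \<open>N > 0\<close> by (auto simp: y_def powr_powr)
  have "y \<le> (lapse M b (3 * M) powr (- 1 / 2)) powr (- 2)"
    unfolding y_def using N by (intro powr_mono2') auto
  then have yl: "y \<le> lapse M b (3 * M)" using N by (simp add: powr_powr)
  have cont: "continuous_on {u..v} (lapse M b)" if "0 < u" for u v
    using that by (intro continuous_intros) auto
  obtain r where "x1 \<le> r" "r \<le> 3 * M" "lapse M b r = y"
    using IVT'[of "lapse M b" x1 y "3 * M"] y yl z 3 cont[OF \<open>0 < x1\<close>] by auto
  then show "\<exists>r. x1 < r \<and> r \<le> 3 * M \<and> lapse M b r powr (- 1 / 2) = N"
    using z y by (intro exI[of _ r]) (auto simp: less_le)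
  obtain r where "3 * M \<le> r" "r \<le> x2" "lapse M b r = y"
    using IVT2'[of "lapse M b" x2 y "3 * M"] y yl z 3 cont[of "3 * M"] M by auto
  then show "\<exists>r. 3 * M \<le> r \<and> r < x2 \<and> lapse M b r powr (- 1 / 2) = N"
    using z y by (intro exI[of _ r]) (auto simp: less_le)
qed

lemma radial_int_unique_root:
  assumes M: "0 < M" and b: "0 < b" and x1: "0 < x1" and 3: "3 * M \<in> {x1<..<x2}"
    and pos: "\<And>x. x1 < x \<Longrightarrow> x < x2 \<Longrightarrow> 0 < lapse M b x"
    and z: "lapse M b x1 = 0" "lapse M b x2 = 0"
  shows "\<exists>!r. x1 < r \<and> r < x2 \<and> c + radial_int M b r = 0"
proof -
  have dom: "(b, x) \<in> lapse_dom M" if "x1 < x" "x < x2" for x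
    using assms that by (auto simp: lapse_dom_def)
  obtain k where k: "k > 0" and cmp: "\<And>p q e. x1 < p \<Longrightarrow> p \<le> q \<Longrightarrow> q < x2 \<Longrightarrow> \<bar>e\<bar> = 1 \<Longrightarrow>
      radial_int M b p + e * k * lapse M b p powr (- 1 / 2)
        \<le> radial_int M b q + e * k * lapse M b q powr (- 1 / 2)"
    using radial_int_comparison[OF M b x1 3 pos] by blast
  define L where "L = lapse M b (3 * M) powr (- 1 / 2)"
  \<comment> \<open>Chosen so that \<open>k * N = k * L + \<bar>c\<bar>\<close>. Comparison with
    \<open>3 * M\<close>, where the integral is 0, then gives at most \<open>- \<bar>c\<bar>\<close>
    at \<open>p\<close> and at least \<open>\<bar>c\<bar>\<close> at \<open>q\<close>: the
    divergence enters as a sign change, without limits.\<close>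
  define N where "N = L + \<bar>c\<bar> / k"
  have "L \<le> N" using k by (simp add: N_def)
  have kN: "k * N = k * L + \<bar>c\<bar>" using k by (simp add: N_def field_simps)
  have J0: "radial_int M b (3 * M) = 0" by (simp add: radial_int_def)
  have L0: "0 < lapse M b (3 * M)" using pos 3 by auto
  note att = lapse_attains[OF M x1 3 z \<open>L \<le> N\<close>[unfolded L_def] L0]
  obtain p where p: "x1 < p" "p \<le> 3 * M" "lapse M b p powr (- 1 / 2) = N" using att(1) by blast
  obtain q where q: "3 * M \<le> q" "q < x2" "lapse M b q powr (- 1 / 2) = N" using att(2) by blast
  have "radial_int M b p + k * N \<le> k * L" "- (k * L) \<le> radial_int M b q - k * N"
    using cmp[of p "3 * M" 1] p cmp[of "3 * M" q "- 1"] q 3 J0 unfolding L_def by auto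
  then have "c + radial_int M b p \<le> 0" "0 \<le> c + radial_int M b q" using kN by auto
  moreover have "continuous_on {p..q} (\<lambda>r. c + radial_int M b r)"
    using p q by (intro continuous_intros continuous_at_imp_continuous_on ballI
        DERIV_isCont[OF radial_int_has_derivative[OF M dom]]) auto
  ultimately obtain r where r: "p \<le> r" "r \<le> q" "c + radial_int M b r = 0"
    using IVT'[of "\<lambda>r. c + radial_int M b r" p 0 q] p q by auto
  show ?thesis
  proof (rule ex1I[of _ r])
    show "x1 < r \<and> r < x2 \<and> c + radial_int M b r = 0" using r p q by auto
    fix r' assume r': "x1 < r' \<and> r' < x2 \<and> c + radial_int M b r' = 0"
    show "r' = r"
      using radial_int_strict_mono[OF M dom dom, of r r'] radial_int_strict_mono[OF M dom dom, of r' r]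
        r r' p q by (cases r r' rule: linorder_cases) auto
  qed
qed

section \<open>Continuously differentiable functions and their graphs\<close>

lemma C1_realD:
  fixes f :: "real \<Rightarrow> real"
  assumes "f C1_differentiable_on S"
  shows "\<And>x. x \<in> S \<Longrightarrow> (f has_real_derivative deriv f x) (at x)"
    and "continuous_on S (deriv f)" and "continuous_on S f"
proof -
  obtain D where D: "\<And>x. x \<in> S \<Longrightarrow> (f has_real_derivative D x) (at x)" "continuous_on S D"
    using assms unfolding C1_differentiable_on_def has_real_derivative_iff_has_vector_derivative
    by blast
  show d: "(f has_real_derivative deriv f x) (at x)" if "x \<in> S" for x
    using D(1)[OF that] DERIV_imp_deriv by metis
  show "continuous_on S (deriv f)"
    by (rule continuous_on_eq[OF D(2)]) (metis D(1) DERIV_imp_deriv)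
  show "continuous_on S f"
    using d by (intro continuous_at_imp_continuous_on ballI) (blast intro: DERIV_isCont)
qed

lemma C1_divide:
  fixes f g :: "real \<Rightarrow> real"
  assumes "f C1_differentiable_on S" "g C1_differentiable_on S" "\<And>x. x \<in> S \<Longrightarrow> g x \<noteq> 0"
  shows "(\<lambda>x. f x / g x) C1_differentiable_on S"
  unfolding C1_differentiable_on_def has_real_derivative_iff_has_vector_derivative[symmetric]
proof (intro exI conjI ballI)
  show "((\<lambda>x. f x / g x) has_real_derivative
      (deriv f x * g x - f x * deriv g x) / (g x * g x)) (at x)" if "x \<in> S" for x
    using that assms C1_realD by (intro DERIV_divide) auto
  show "continuous_on S (\<lambda>x. (deriv f x * g x - f x * deriv g x) / (g x * g x))"
    using assms C1_realD by (intro continuous_intros) auto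
qed

lemma C1_hypersurface_graph:
  fixes \<phi> :: "real \<Rightarrow> real"
  assumes T: "open T" and \<phi>: "\<phi> C1_differentiable_on T"
  shows "C1_hypersurface {(t, r). t \<in> T \<and> r = \<phi> t}"
  unfolding C1_hypersurface_def
proof
  fix p assume p: "p \<in> {(t, r). t \<in> T \<and> r = \<phi> t}"
  define U where "U = T \<times> (UNIV :: real set)"
  define F where "F x = snd x - \<phi> (fst x)" for x :: "real \<times> real"
  define G where "G x = (- deriv \<phi> (fst x), 1 :: real)" for x :: "real \<times> real"
  have "open U" "p \<in> U" using T p by (auto simp: U_def open_Times)
  moreover have "(F has_derivative (\<lambda>h. G x \<bullet> h)) (at x) \<and> G x \<noteq> 0" if "x \<in> U" for x
  proof
    have "fst x \<in> T" using that by (auto simp: U_def)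
    then have "(\<phi> has_derivative (*) (deriv \<phi> (fst x))) (at (fst x))"
      using C1_realD(1)[OF \<phi>] by (simp add: has_field_derivative_def)
    then have "((\<lambda>x. \<phi> (fst x)) has_derivative (\<lambda>h. deriv \<phi> (fst x) * fst h)) (at x)"
      by (intro has_derivative_compose[OF has_derivative_fst[OF has_derivative_ident]])
    then show "(F has_derivative (\<lambda>h. G x \<bullet> h)) (at x)"
      unfolding F_def G_def
      by (auto intro!: derivative_eq_intros simp: inner_prod_def inner_real_def)
  qed (simp add: G_def zero_prod_def)
  moreover have "continuous_on U G"
    unfolding G_def U_def
    by (intro continuous_intros continuous_on_compose2[OF C1_realD(2)[OF \<phi>]]) auto
  moreover have "{(t, r). t \<in> T \<and> r = \<phi> t} \<inter> U = {x \<in> U. F x = 0}"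
    by (auto simp: U_def F_def)
  ultimately show "\<exists>U F G. open U \<and> p \<in> U \<and>
        (\<forall>x\<in>U. ((F :: real \<times> real \<Rightarrow> real) has_derivative (\<lambda>h. G x \<bullet> h)) (at x) \<and> G x \<noteq> 0) \<and>
        continuous_on U G \<and> {(t, r). t \<in> T \<and> r = \<phi> t} \<inter> U = {x \<in> U. F x = 0}"
    by blast
qed

text \<open>A curve in the lifted graph satisfies two constraints near parameter 0,
  \<open>r = \<phi> t\<close> and \<open>norm \<omega> = 1\<close>. Differentiating the first by the
  chain rule and the second as \<open>\<omega> \<bullet> \<omega> = 1\<close> gives the two
  conclusions.\<close>

lemma tangent_vectors_graph_lift:
  assumes v: "(\<tau>, \<rho>, w) \<in> tangent_vectors (spherical_lift {(t, r). t \<in> T \<and> r = \<phi> t}) (t, r, \<omega>)"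
    and \<phi>: "(\<phi> has_real_derivative m) (at t)"
  shows "\<rho> = m * \<tau>" and "w \<bullet> \<omega> = 0"
proof -
  obtain \<gamma> where \<gamma>0: "\<gamma> 0 = (t, r, \<omega>)"
    and ev: "\<forall>\<^sub>F x in nhds (0::real). \<gamma> x \<in> spherical_lift {(t, r). t \<in> T \<and> r = \<phi> t}"
    and d: "(\<gamma> has_vector_derivative (\<tau>, \<rho>, w)) (at 0)"
    using v by (auto simp: tangent_vectors_def)
  define x y z where "x s = fst (\<gamma> s)" and "y s = fst (snd (\<gamma> s))" and "z s = snd (snd (\<gamma> s))" for s
  note fst' = bounded_linear.has_vector_derivative[OF bounded_linear_fst]
  note snd' = bounded_linear.has_vector_derivative[OF bounded_linear_snd]
  have dx: "(x has_real_derivative \<tau>) (at 0)" and dy: "(y has_real_derivative \<rho>) (at 0)"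
    and dz: "(z has_vector_derivative w) (at 0)"
    using fst'[OF d] fst'[OF snd'[OF d]] snd'[OF snd'[OF d]]
    by (simp_all add: x_def[abs_def] y_def[abs_def] z_def[abs_def]
        has_real_derivative_iff_has_vector_derivative)
  have evy: "\<forall>\<^sub>F s in nhds 0. \<phi> (x s) = y s" and evz: "\<forall>\<^sub>F s in nhds 0. z s \<bullet> z s = 1"
    using ev by (auto elim!: eventually_mono simp: x_def y_def z_def spherical_lift_def norm_eq_1 case_prod_unfold)
  have "x 0 = t" "z 0 = \<omega>" by (simp_all add: x_def z_def \<gamma>0)
  have "((\<lambda>s. \<phi> (x s)) has_real_derivative m * \<tau>) (at 0)"
    using DERIV_chain2[of \<phi> m x 0 \<tau> UNIV] \<phi> dx \<open>x 0 = t\<close> by simp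
  then have "(y has_real_derivative m * \<tau>) (at 0)"
    using DERIV_cong_ev[OF refl evy refl] by simp
  then show "\<rho> = m * \<tau>" using dy DERIV_unique by blast
  have "((\<lambda>s. z s \<bullet> z s) has_real_derivative w \<bullet> \<omega> + \<omega> \<bullet> w) (at 0)"
    using bounded_bilinear.has_vector_derivative[OF bounded_bilinear_inner dz dz] \<open>z 0 = \<omega>\<close>
    by (simp add: has_real_derivative_iff_has_vector_derivative add.commute)
  then have "((\<lambda>s. 1 :: real) has_real_derivative w \<bullet> \<omega> + \<omega> \<bullet> w) (at 0)"
    using DERIV_cong_ev[OF refl evz refl] by simp
  then have "w \<bullet> \<omega> + \<omega> \<bullet> w = 0" using DERIV_unique DERIV_const by blast
  then show "w \<bullet> \<omega> = 0" by (simp add: inner_commute)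
qed

section \<open>The spacetime at fixed mass\<close>

text \<open>\<open>S\<close> stands for \<open>s M\<close> at the given mass. The energy condition
  is left to the lemmas on pressure and energy; the geometry of the surface does without it.\<close>

locale mcvittie =
  fixes M :: real and I :: "real set" and a S :: "real \<Rightarrow> real"
  assumes M: "0 < M" and I: "open I" and a_pos: "\<And>t. t \<in> I \<Longrightarrow> 0 < a t"
    and a_C1: "a C1_differentiable_on I" "deriv a C1_differentiable_on I"
    and S_C1: "S C1_differentiable_on I0 M I a"
begin

abbreviation "T \<equiv> I0 M I a"
abbreviation "H \<equiv> hubble a"
abbreviation "\<rho>\<^sub>0 \<equiv> r0 M a S"

lemma hubble_C1: "H C1_differentiable_on I"
  unfolding hubble_def[abs_def] using a_C1 a_pos by (intro C1_divide) force+

lemma T_sub: "T \<subseteq> I"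
  by (auto simp: I0_def)

lemma open_T: "open T"
proof -
  have "T = (I \<inter> a -` {3 * sqrt 3 * M<..}) \<inter> (I \<inter> H -` (- {0}))" by (auto simp: I0_def)
  then show ?thesis
    using I C1_realD(3)[OF a_C1(1)] C1_realD(3)[OF hubble_C1]
    by (metis open_Int continuous_open_preimage open_greaterThan open_Compl closed_singleton)
qed

lemma C1_T: "f C1_differentiable_on I \<Longrightarrow> f C1_differentiable_on T"
  using T_sub C1_differentiable_on_subset by blast

definition b :: "real \<Rightarrow> real" where "b t = 1 / (a t)\<^sup>2"

definition offset :: "real \<Rightarrow> real" where "offset t = S t * (a t)\<^sup>2 / H t"

definition F :: "real \<Rightarrow> real \<Rightarrow> real" where "F t r = offset t + radial_int M (b t) r"

definition region :: "(real \<times> real) set" where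
  "region = {(t, r). t \<in> T \<and> r1 M a t < r \<and> r < r2 M a t}"

lemma b_C1: "b C1_differentiable_on I"
  unfolding b_def[abs_def] power2_eq_square using a_C1 a_pos
  by (intro C1_divide C1_differentiable_on_mult) force+

lemma offset_C1: "offset C1_differentiable_on T"
  unfolding offset_def[abs_def] power2_eq_square using a_C1 hubble_C1 S_C1
  by (intro C1_divide C1_differentiable_on_mult S_C1 C1_T) (auto simp: I0_def)

lemma T_nz: "t \<in> T \<Longrightarrow> a t \<noteq> 0" "t \<in> T \<Longrightarrow> H t \<noteq> 0"
  using a_pos by (force simp: I0_def)+

lemma b_pos: "t \<in> T \<Longrightarrow> 0 < b t"
  using a_pos by (force simp: b_def I0_def)

lemma zeros:
  assumes t: "t \<in> T"
  shows "0 < r1 M a t" "3 * M \<in> {r1 M a t<..<r2 M a t}"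
    and "lapse M (b t) (r1 M a t) = 0" "lapse M (b t) (r2 M a t) = 0"
    and "0 < r \<Longrightarrow> 0 < lapse M (b t) r \<longleftrightarrow> r1 M a t < r \<and> r < r2 M a t"
proof -
  have at: "a t > 3 * sqrt 3 * M" using t by (auto simp: I0_def)
  note kz = kappa_zeros[of M a t, OF M at]
  show "0 < r1 M a t" by (rule kz)
  have "r1 M a t \<in> {r. 0 < r \<and> kappa M a t r = 0}" "r2 M a t \<in> {r. 0 < r \<and> kappa M a t r = 0}"
    unfolding kz(1) by auto
  then show "lapse M (b t) (r1 M a t) = 0" "lapse M (b t) (r2 M a t) = 0"
    by (auto simp: kappa_eq_lapse b_def)
  show iff: "0 < lapse M (b t) r \<longleftrightarrow> r1 M a t < r \<and> r < r2 M a t" if "0 < r" for r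
    using kz(4)[OF that] by (simp add: kappa_eq_lapse b_def)
  \<comment> \<open>At \<open>3 * M\<close> the lapse equals 1/3 - 9 M^2 / a^2, which is positive
    exactly when a^2 > 27 M^2.\<close>
  have "(3 * sqrt 3 * M)\<^sup>2 < (a t)\<^sup>2" using M at by (intro power_strict_mono) auto
  then have "27 * M\<^sup>2 < (a t)\<^sup>2" by (simp add: power_mult_distrib)
  then have "0 < lapse M (b t) (3 * M)"
    using M T_nz(1)[OF t] by (simp add: lapse_def b_def field_simps)
  then show "3 * M \<in> {r1 M a t<..<r2 M a t}" using iff[of "3 * M"] M by auto
qed

text \<open>This presents \<open>region\<close> as a preimage of \<open>lapse_dom M\<close> under a
  continuous map, so its openness needs no regularity of \<open>r1\<close> and \<open>r2\<close> in
  time.\<close>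

lemma region_iff: "(t, r) \<in> region \<longleftrightarrow> t \<in> T \<and> (b t, r) \<in> lapse_dom M"
proof (cases "t \<in> T")
  case True
  then show ?thesis
    using zeros[OF True] b_pos[OF True] zeros(5)[OF True, of "3 * M"] M
    by (auto simp: region_def lapse_dom_def)
qed (simp add: region_def)

lemma region_allowed: "region \<subseteq> allowed_region M I a"
  using zeros(1,5) T_sub
  by (fastforce simp: region_def allowed_region_def kappa_eq_lapse b_def)

lemma continuous_on_b_pair: "continuous_on region (\<lambda>(t, r). (b t, r))"
proof -
  have "continuous_on (T \<times> UNIV) (\<lambda>p. (b (fst p), snd p :: real))"
    by (intro continuous_intros continuous_on_compose2[OF C1_realD(3)[OF C1_T[OF b_C1]]]) auto
  then show ?thesis
    unfolding case_prod_beta by (rule continuous_on_subset) (auto simp: region_def)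
qed

lemma open_region: "open region"
proof -
  have "continuous_on (T \<times> UNIV) (\<lambda>p. (b (fst p), snd p :: real))"
    by (intro continuous_intros continuous_on_compose2[OF C1_realD(3)[OF C1_T[OF b_C1]]]) auto
  then have "open (T \<times> UNIV \<inter> (\<lambda>p. (b (fst p), snd p)) -` lapse_dom M)"
    by (intro continuous_open_preimage open_Times open_T open_lapse_dom M) auto
  moreover have "region = T \<times> UNIV \<inter> (\<lambda>p. (b (fst p), snd p)) -` lapse_dom M"
    using region_iff by auto
  ultimately show ?thesis by simp
qed

lemma continuous_on_region_fst:
  assumes "continuous_on T f" shows "continuous_on region (\<lambda>p. f (fst p))"
  by (intro continuous_on_compose2[OF assms] continuous_intros) (auto simp: region_def)

lemma continuous_on_F: "continuous_on region (\<lambda>(t, r). F t r)"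
proof -
  have "continuous_on region (\<lambda>p. case (b (fst p), snd p) of (\<beta>, r) \<Rightarrow> radial_int M \<beta> r)"
    using continuous_on_b_pair region_iff
    by (intro continuous_on_compose2[OF continuous_on_radial_int[OF M]]) (auto simp: case_prod_beta)
  then show ?thesis
    unfolding F_def case_prod_beta
    by (intro continuous_intros continuous_on_region_fst C1_realD(3)[OF offset_C1]) simp
qed

lemma F_unique_root: "t \<in> T \<Longrightarrow> \<exists>!r. r1 M a t < r \<and> r < r2 M a t \<and> F t r = 0"
  unfolding F_def using zeros(1,5)[of t]
  by (intro radial_int_unique_root M b_pos zeros) auto

lemma F_strict_mono: "(t, r) \<in> region \<Longrightarrow> (t, r') \<in> region \<Longrightarrow> r < r' \<Longrightarrow> F t r < F t r'"
  by (simp add: F_def region_iff radial_int_strict_mono[OF M])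

section \<open>The zero of sigma and its dependence on time\<close>

lemma sigma_eq:
  assumes "(t, r) \<in> region"
  shows "sigma M a S t r = lapse M (b t) r powr (1 / 2) * (H t / (a t)\<^sup>2) * F t r"
proof -
  have "H t \<noteq> 0" "a t \<noteq> 0" using assms T_nz by (auto simp: region_def)
  moreover have "kappa M a t x = lapse M (b t) x" for x by (simp add: kappa_eq_lapse b_def)
  ultimately show ?thesis
    by (simp add: sigma_def F_def offset_def radial_int_def field_simps)
qed

lemma sigma_eq_0_iff:
  assumes "(t, r) \<in> region"
  shows "sigma M a S t r = 0 \<longleftrightarrow> F t r = 0"
proof -
  have "H t \<noteq> 0" "a t \<noteq> 0" using assms T_nz by (auto simp: region_def)
  moreover have "lapse M (b t) r \<noteq> 0" using assms by (auto simp: region_iff lapse_dom_def)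
  ultimately show ?thesis by (simp add: sigma_eq[OF assms])
qed

lemma sigma_unique_root:
  assumes "t \<in> T" shows "\<exists>!r. r1 M a t < r \<and> r < r2 M a t \<and> sigma M a S t r = 0"
proof -
  have "(r1 M a t < r \<and> r < r2 M a t \<and> sigma M a S t r = 0) \<longleftrightarrow>
      (r1 M a t < r \<and> r < r2 M a t \<and> F t r = 0)" for r
    using sigma_eq_0_iff[of t r] assms by (auto simp: region_def)
  then show ?thesis using F_unique_root[OF assms] by simp
qed

lemma r0_root:
  assumes "t \<in> T" shows "(t, \<rho>\<^sub>0 t) \<in> region" "F t (\<rho>\<^sub>0 t) = 0"
proof -
  have "r1 M a t < \<rho>\<^sub>0 t \<and> \<rho>\<^sub>0 t < r2 M a t \<and> sigma M a S t (\<rho>\<^sub>0 t) = 0"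
    unfolding r0_def by (rule theI') (rule sigma_unique_root[OF assms])
  then show "(t, \<rho>\<^sub>0 t) \<in> region" "F t (\<rho>\<^sub>0 t) = 0"
    using assms sigma_eq_0_iff by (auto simp: region_def)
qed

lemma F_root_eq: "(t, r) \<in> region \<Longrightarrow> F t r = 0 \<Longrightarrow> r = \<rho>\<^sub>0 t"
  using F_strict_mono[of t r "\<rho>\<^sub>0 t"] F_strict_mono[of t "\<rho>\<^sub>0 t" r] r0_root[of t]
  by (cases r "\<rho>\<^sub>0 t" rule: linorder_cases) (auto simp: region_def)

text \<open>The implicit function theorem is applied to \<open>F\<close> instead of
  \<open>sigma\<close>: its radial derivative is the bare integrand, positive for either sign of
  \<open>H\<close>. Time acts through \<open>offset\<close> and, by the chain rule, through
  \<open>b\<close>.\<close>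

lemma r0_C1: "\<rho>\<^sub>0 C1_differentiable_on T"
proof (rule implicit_function_C1[where S = region and F = F and \<phi> = \<rho>\<^sub>0
      and Ft = "\<lambda>t r. deriv offset t + radial_int_deriv M (b t) r * deriv b t"
      and Fr = "\<lambda>t r. r * lapse M (b t) r powr (- 3 / 2)",
      OF open_region r0_root open_T F_root_eq])
  fix t r assume tr: "(t, r) \<in> region"
  then have t: "t \<in> T" and dom: "(b t, r) \<in> lapse_dom M" by (auto simp: region_iff)
  show "((\<lambda>\<tau>. F \<tau> r) has_real_derivative
      deriv offset t + radial_int_deriv M (b t) r * deriv b t) (at t)"
    unfolding F_def
    by (intro DERIV_add C1_realD(1)[OF offset_C1 t] C1_realD(1)[OF C1_T[OF b_C1] t]
        DERIV_chain2[where f = "\<lambda>\<beta>. radial_int M \<beta> r" and g = b]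
        radial_int_has_derivative_param[OF M dom])
  show "(F t has_real_derivative r * lapse M (b t) r powr (- 3 / 2)) (at r)"
    unfolding F_def[abs_def]
    using radial_int_has_derivative[OF M dom] by (auto intro!: derivative_eq_intros)
  show "0 < r * lapse M (b t) r powr (- 3 / 2)" using dom by (auto simp: lapse_dom_def)
next
  have "continuous_on region (\<lambda>p. case (b (fst p), snd p) of (\<beta>, r) \<Rightarrow> radial_int_deriv M \<beta> r)"
    using continuous_on_b_pair region_iff
    by (intro continuous_on_compose2[OF continuous_on_radial_int_deriv[OF M]]) (auto simp: case_prod_beta)
  then show "continuous_on region (\<lambda>(t, r). deriv offset t + radial_int_deriv M (b t) r * deriv b t)"
    unfolding case_prod_beta
    by (intro continuous_intros continuous_on_region_fst C1_realD(2)[OF offset_C1]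
        C1_realD(2)[OF C1_T[OF b_C1]]) simp
  have "snd p \<noteq> 0" "lapse M (b (fst p)) (snd p) \<noteq> 0" if "p \<in> region" for p
    using that region_iff[of "fst p" "snd p"] by (auto simp: lapse_dom_def)
  then show "continuous_on region (\<lambda>(t, r). r * lapse M (b t) r powr (- 3 / 2))"
    unfolding case_prod_beta
    by (intro continuous_intros continuous_on_region_fst C1_realD(3)[OF C1_T[OF b_C1]]) auto
qed

section \<open>Causal character of the surface\<close>

lemma Sigma0_graph: "Sigma0 M I a S = {(t, r). t \<in> T \<and> r = \<rho>\<^sub>0 t}"
  by (simp add: Sigma0_def)

lemma Sigma0_allowed: "Sigma0 M I a S \<subseteq> allowed_region M I a"
  using r0_root region_allowed by (auto simp: Sigma0_def)

text \<open>Every term of the metric with a time component carries a factor \<open>sigma\<close>,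
  which vanishes here.\<close>

lemma metric_Sigma0:
  assumes t: "t \<in> T"
  shows "mcv_metric M a S (t, \<rho>\<^sub>0 t, \<omega>) (\<tau>, \<rho>, w) (\<tau>', \<rho>', w') =
      \<rho> * \<rho>' / kappa M a t (\<rho>\<^sub>0 t) + (\<rho>\<^sub>0 t)\<^sup>2 * (w \<bullet> w')"
    and "0 < kappa M a t (\<rho>\<^sub>0 t)" "0 < \<rho>\<^sub>0 t"
proof -
  have "sigma M a S t (\<rho>\<^sub>0 t) = 0" using r0_root[OF t] sigma_eq_0_iff by simp
  then show "mcv_metric M a S (t, \<rho>\<^sub>0 t, \<omega>) (\<tau>, \<rho>, w) (\<tau>', \<rho>', w') =
      \<rho> * \<rho>' / kappa M a t (\<rho>\<^sub>0 t) + (\<rho>\<^sub>0 t)\<^sup>2 * (w \<bullet> w')"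
    by (simp add: mcv_metric_def)
  show "0 < kappa M a t (\<rho>\<^sub>0 t)" "0 < \<rho>\<^sub>0 t"
    using r0_root(1)[OF t] region_allowed by (auto simp: allowed_region_def)
qed

lemma metric_Sigma0_pos:
  assumes t: "t \<in> T" and "\<rho> \<noteq> 0 \<or> w \<noteq> 0"
  shows "0 < mcv_metric M a S (t, \<rho>\<^sub>0 t, \<omega>) (\<tau>, \<rho>, w) (\<tau>, \<rho>, w)"
proof -
  note pos = metric_Sigma0(2,3)[OF t]
  have "0 \<le> \<rho> * \<rho> / kappa M a t (\<rho>\<^sub>0 t)" "0 \<le> (\<rho>\<^sub>0 t)\<^sup>2 * (w \<bullet> w)" using pos by auto
  moreover have "0 < \<rho> * \<rho> / kappa M a t (\<rho>\<^sub>0 t)" if "\<rho> \<noteq> 0"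
    using that pos by (metis divide_pos_pos not_real_square_gt_zero)
  moreover have "0 < (\<rho>\<^sub>0 t)\<^sup>2 * (w \<bullet> w)" if "w \<noteq> 0" using that pos by auto
  ultimately show ?thesis
    unfolding metric_Sigma0(1)[OF t] using assms(2) by (meson add_nonneg_pos add_pos_nonneg)
qed

lemma tangent_Sigma0:
  assumes "t \<in> T" and "(\<tau>, \<rho>, w) \<in> tangent_vectors (spherical_lift (Sigma0 M I a S)) (t, r, \<omega>)"
  shows "\<rho> = deriv \<rho>\<^sub>0 t * \<tau>" "w \<bullet> \<omega> = 0"
  using tangent_vectors_graph_lift[OF assms(2)[unfolded Sigma0_graph] C1_realD(1)[OF r0_C1 assms(1)]]
  by auto

lemma spacelike_mod_radical_Sigma0:
  assumes "p \<in> spherical_lift (Sigma0 M I a S)"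
  shows "spacelike_mod_radical_at (mcv_metric M a S) (spherical_lift (Sigma0 M I a S)) p"
proof -
  obtain t \<omega> where p: "p = (t, \<rho>\<^sub>0 t, \<omega>)" and t: "t \<in> T"
    using assms by (auto simp: spherical_lift_def Sigma0_def)
  have "0 < mcv_metric M a S p v v"
    if v: "v \<in> tangent_vectors (spherical_lift (Sigma0 M I a S)) p"
      and nr: "v \<notin> radical (mcv_metric M a S) p" for v
  proof -
    obtain \<tau> \<rho> w where v_eq: "v = (\<tau>, \<rho>, w)" by (metis prod_cases3)
    have "v \<in> tangent_space p"
      using tangent_Sigma0(2)[OF t] v unfolding v_eq p by (simp add: tangent_space_def)
    \<comment> \<open>A tangent vector outside the radical pairs nontrivially with some
      \<open>u\<close>. As time components do not contribute to the pairing, \<open>\<rho>\<close>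
      or \<open>w\<close> must be nonzero.\<close>
    then obtain u where "mcv_metric M a S p u v \<noteq> 0" using nr by (auto simp: radical_def)
    then have "\<rho> \<noteq> 0 \<or> w \<noteq> 0"
      using metric_Sigma0(1)[OF t] unfolding v_eq p by (cases u) auto
    then show ?thesis unfolding v_eq p by (rule metric_Sigma0_pos[OF t])
  qed
  then show ?thesis by (simp add: spacelike_mod_radical_at_def)
qed

text \<open>Only vectors \<open>(\<tau>, 0, 0)\<close> have zero length. Tangency forces
  \<open>\<rho> = deriv \<rho>\<^sub>0 t * \<tau>\<close>, which excludes them when the slope is
  nonzero; at zero slope such a direction is tangent, hence the second assumption.\<close>

lemma spacelike_Sigma0:
  assumes "(t, r, \<omega>) \<in> spherical_lift (Sigma0 M I a S)" and "deriv \<rho>\<^sub>0 t \<noteq> 0"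
  shows "spacelike_at (mcv_metric M a S) (spherical_lift (Sigma0 M I a S)) (t, r, \<omega>)"
proof -
  have t: "t \<in> T" and r: "r = \<rho>\<^sub>0 t" using assms by (auto simp: spherical_lift_def Sigma0_def)
  have "0 < mcv_metric M a S (t, r, \<omega>) v v"
    if v: "v \<in> tangent_vectors (spherical_lift (Sigma0 M I a S)) (t, r, \<omega>)" and "v \<noteq> 0" for v
  proof -
    obtain \<tau> \<rho> w where v_eq: "v = (\<tau>, \<rho>, w)" by (metis prod_cases3)
    have "\<rho> \<noteq> 0 \<or> w \<noteq> 0"
      using tangent_Sigma0(1)[OF t v[unfolded v_eq]] \<open>v \<noteq> 0\<close> assms(2)
      by (auto simp: v_eq zero_prod_def)
    then show ?thesis unfolding v_eq r by (rule metric_Sigma0_pos[OF t])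
  qed
  then show ?thesis by (simp add: spacelike_at_def)
qed

section \<open>Divergence of the pressure and the energy condition\<close>

abbreviation "rate \<equiv> deriv (\<lambda>\<tau>. (H \<tau>)\<^sup>2 + 1 / (a \<tau>)\<^sup>2)"

lemma curvature_C1: "(\<lambda>\<tau>. (H \<tau>)\<^sup>2 + 1 / (a \<tau>)\<^sup>2) C1_differentiable_on I"
  using C1_differentiable_on_add[OF C1_differentiable_on_mult[OF hubble_C1 hubble_C1] b_C1]
  by (simp add: b_def power2_eq_square)

lemma rate_eq:
  assumes t: "t \<in> I" shows "rate t = 2 * H t * (deriv H t - 1 / (a t)\<^sup>2)"
proof -
  have "a t \<noteq> 0" using a_pos[OF t] by simp
  note C1_realD(1)[OF hubble_C1 t, derivative_intros] C1_realD(1)[OF a_C1(1) t, derivative_intros]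
  have "((\<lambda>\<tau>. (H \<tau>)\<^sup>2 + 1 / (a \<tau>)\<^sup>2) has_real_derivative
      2 * H t * deriv H t - 2 * deriv a t / a t ^ 3) (at t)"
    using \<open>a t \<noteq> 0\<close>
    by (auto intro!: derivative_eq_intros simp: field_simps power2_eq_square power3_eq_cube)
  then have "rate t = 2 * H t * deriv H t - 2 * deriv a t / a t ^ 3" by (rule DERIV_imp_deriv)
  then show ?thesis
    using \<open>a t \<noteq> 0\<close> by (simp add: hubble_def[of a t] field_simps power2_eq_square power3_eq_cube)
qed

text \<open>The pressure is a convergent term plus \<open>inverse sigma\<close> times a factor with
  nonzero limit. The limit is taken off the surface, where \<open>inverse 0 = 0\<close> cannot
  interfere, and is unsigned because \<open>sigma\<close> changes sign across it.\<close>

lemma pressure_at_infinity: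
  assumes ec: "\<And>t. t \<in> I \<Longrightarrow> deriv H t < 1 / (a t)\<^sup>2" and p: "p \<in> Sigma0 M I a S"
  shows "filterlim (\<lambda>(t, r). mcv_pressure M \<Lambda> a S t r) at_infinity
    (at p within (allowed_region M I a - Sigma0 M I a S))" (is "filterlim _ _ ?net")
proof -
  have pr: "p \<in> region" using p r0_root by (auto simp: Sigma0_def)
  then have t: "fst p \<in> T" "fst p \<in> I" using T_sub by (auto simp: region_def)
  have lim: "(f \<longlongrightarrow> f p) ?net" if "continuous_on region f" for f :: "real \<times> real \<Rightarrow> real"
  proof -
    have "isCont f p" using that pr open_region continuous_on_eq_continuous_at by blast
    then show ?thesis by (meson continuous_at_imp_continuous_at_within continuous_within)
  qed
  have region: "\<forall>\<^sub>F q in ?net. q \<in> region"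
    using topological_tendstoD[OF tendsto_ident_at open_region pr] .
  have "continuous_on region (\<lambda>p. sigma M a S (fst p) (snd p))"
  proof (rule continuous_on_eq)
    have "a (fst q) \<noteq> 0" "lapse M (b (fst q)) (snd q) \<noteq> 0" "snd q \<noteq> 0" if "q \<in> region" for q
      using that region_iff[of "fst q" "snd q"] T_nz(1)[of "fst q"] by (auto simp: lapse_dom_def)
    then show "continuous_on region (\<lambda>q. lapse M (b (fst q)) (snd q) powr (1 / 2) *
        (H (fst q) / (a (fst q))\<^sup>2) * F (fst q) (snd q))"
      using continuous_on_F unfolding case_prod_beta
      by (intro continuous_intros continuous_on_region_fst C1_realD(3)[OF C1_T[OF b_C1]]
          C1_realD(3)[OF C1_T[OF hubble_C1]] C1_realD(3)[OF C1_T[OF a_C1(1)]]) auto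
    show "lapse M (b (fst q)) (snd q) powr (1 / 2) * (H (fst q) / (a (fst q))\<^sup>2) * F (fst q) (snd q)
      = sigma M a S (fst q) (snd q)" if "q \<in> region" for q
      using that by (simp add: sigma_eq)
  qed
  then have "((\<lambda>q. sigma M a S (fst q) (snd q)) \<longlongrightarrow> sigma M a S (fst p) (snd p)) ?net" by (rule lim)
  moreover have "sigma M a S (fst p) (snd p) = 0"
    using p r0_root sigma_eq_0_iff by (auto simp: Sigma0_def)
  \<comment> \<open>Close to \<open>p\<close> all events lie in the open \<open>region\<close>,
    where for each time \<open>sigma\<close> vanishes only at \<open>\<rho>\<^sub>0\<close>; off the
    surface it is therefore nonzero.\<close>
  moreover have "\<forall>\<^sub>F q in ?net. sigma M a S (fst q) (snd q) \<noteq> 0"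
  proof -
    have "\<forall>\<^sub>F q in ?net. q \<in> allowed_region M I a - Sigma0 M I a S"
      by (auto simp: eventually_at_filter)
    with region show ?thesis
    proof eventually_elim
      case (elim q)
      then show ?case
        using sigma_eq_0_iff[of "fst q" "snd q"] F_root_eq[of "fst q" "snd q"]
        by (auto simp: Sigma0_def region_def)
    qed
  qed
  ultimately have "filterlim (\<lambda>q. sigma M a S (fst q) (snd q)) (at 0) ?net"
    by (simp add: filterlim_at)
  then have inv: "filterlim (\<lambda>q. inverse (sigma M a S (fst q) (snd q))) at_infinity ?net"
    by (rule filterlim_compose[OF filterlim_inverse_at_infinity])
  have "((\<lambda>q. - rate (fst q) / (8 * pi)) \<longlongrightarrow> - rate (fst p) / (8 * pi)) ?net"
    by (intro tendsto_intros lim continuous_on_region_fst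
        C1_realD(2)[OF C1_T[OF curvature_C1]]) auto
  \<comment> \<open>Here the energy condition enters: it makes the factor
    \<open>deriv H t - 1 / (a t)\<^sup>2\<close> of \<open>rate\<close> nonzero, and
    \<open>H\<close> is nonzero on \<open>T\<close>.\<close>
  moreover have "- rate (fst p) / (8 * pi) \<noteq> 0"
    using rate_eq[OF t(2)] ec[OF t(2)] t(1) by (auto simp: I0_def)
  ultimately have "filterlim (\<lambda>q. - rate (fst q) / (8 * pi) * inverse (sigma M a S (fst q) (snd q)))
      at_infinity ?net"
    using inv by (rule tendsto_mult_filterlim_at_infinity)
  moreover have "((\<lambda>q. (\<Lambda> - 3 * ((H (fst q))\<^sup>2 + 1 / (a (fst q))\<^sup>2)) / (8 * pi)) \<longlongrightarrow>
      (\<Lambda> - 3 * ((H (fst p))\<^sup>2 + 1 / (a (fst p))\<^sup>2)) / (8 * pi)) ?net"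
    by (intro tendsto_intros lim continuous_on_region_fst[where f = "\<lambda>\<tau>. (H \<tau>)\<^sup>2 + 1 / (a \<tau>)\<^sup>2"]
        C1_realD(3)[OF C1_T[OF curvature_C1]]) auto
  ultimately have "filterlim (\<lambda>q. (\<Lambda> - 3 * ((H (fst q))\<^sup>2 + 1 / (a (fst q))\<^sup>2)) / (8 * pi) +
      - rate (fst q) / (8 * pi) * inverse (sigma M a S (fst q) (snd q))) at_infinity ?net"
    by (intro tendsto_add_filterlim_at_infinity)
  then show ?thesis
    by (rule filterlim_cong[THEN iffD1, OF refl refl always_eventually, rotated])
      (auto simp: mcv_pressure_def diff_divide_distrib mult.commute)
qed

lemma energy_condition_violated:
  assumes ec: "\<And>t. t \<in> I \<Longrightarrow> deriv H t < 1 / (a t)\<^sup>2" and "(t, r) \<in> R1 M I a S"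
  shows "\<not> weak_energy_condition (mcv_density \<Lambda> a t) (mcv_pressure M \<Lambda> a S t r)"
proof -
  have t: "t \<in> T" "t \<in> I" and r: "r1 M a t < r" "r < \<rho>\<^sub>0 t"
    using assms T_sub by (auto simp: R1_def)
  then have reg: "(t, r) \<in> region" using r0_root(1)[OF t(1)] by (auto simp: region_def)
  have F: "F t r < 0" using F_strict_mono[OF reg r0_root(1)[OF t(1)] r(2)] r0_root(2)[OF t(1)] by simp
  define l where "l = lapse M (b t) r powr (1 / 2)"
  have l: "0 < l" using reg by (auto simp: l_def region_iff lapse_dom_def)
  have a: "0 < a t" and H: "H t \<noteq> 0" using t a_pos by (auto simp: I0_def)
  have "inverse (sigma M a S t r) * rate t =
      2 * (a t)\<^sup>2 * (1 / (a t)\<^sup>2 - deriv H t) / (l * (- F t r))"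
    unfolding sigma_eq[OF reg] rate_eq[OF t(2)] l_def[symmetric]
    using a H l F by (simp add: field_simps)
  also have "\<dots> > 0" using a l F ec[OF t(2)] by (intro divide_pos_pos mult_pos_pos) auto
  finally have "0 < inverse (sigma M a S t r) * rate t" .
  \<comment> \<open>The terms in \<open>\<Lambda>\<close> and in
    \<open>(H t)\<^sup>2 + 1 / (a t)\<^sup>2\<close> cancel in the sum, so it is the inequality for
    density plus pressure that fails.\<close>
  moreover have "mcv_density \<Lambda> a t + mcv_pressure M \<Lambda> a S t r =
      - (inverse (sigma M a S t r) * rate t) / (8 * pi)"
    by (simp add: mcv_density_def mcv_pressure_def field_simps)
  ultimately show ?thesis by (simp add: weak_energy_condition_def divide_less_0_iff not_le)
qed

end

theorem proposition4p3:
  fixes M \<Lambda> :: real and I :: "real set" and a :: "real \<Rightarrow> real" and s :: "real \<Rightarrow> real \<Rightarrow> real"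
  assumes "M > 0"
    and "open I" and "is_interval I"
    and "\<And>t. t \<in> I \<Longrightarrow> a t > 0"
    and "a C1_differentiable_on I" and "deriv a C1_differentiable_on I"
    and "\<And>t. t \<in> I \<Longrightarrow> flrw_density \<Lambda> a t > 0"
    and "\<And>t. t \<in> I \<Longrightarrow> flrw_density \<Lambda> a t + flrw_pressure \<Lambda> a t > 0"
    and "\<And>t. t \<in> I \<Longrightarrow> ((\<lambda>m. s m t) \<longlongrightarrow> hubble a t) (at_right 0)"
    and "s M C1_differentiable_on I0 M I a"
  shows "(\<forall>t\<in>I0 M I a. \<exists>!r. r1 M a t < r \<and> r < r2 M a t \<and> sigma M a (s M) t r = 0)
    \<and> Sigma0 M I a (s M) \<subseteq> allowed_region M I a
    \<and> r0 M a (s M) C1_differentiable_on I0 M I a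
    \<and> C1_hypersurface (Sigma0 M I a (s M))
    \<and> (\<forall>p\<in>spherical_lift (Sigma0 M I a (s M)).
         spacelike_mod_radical_at (mcv_metric M a (s M)) (spherical_lift (Sigma0 M I a (s M))) p)
    \<and> (\<forall>(t, r, \<omega>)\<in>spherical_lift (Sigma0 M I a (s M)). deriv (r0 M a (s M)) t \<noteq> 0 \<longrightarrow>
         spacelike_at (mcv_metric M a (s M)) (spherical_lift (Sigma0 M I a (s M))) (t, r, \<omega>))
    \<and> (\<forall>p\<in>Sigma0 M I a (s M).
         filterlim (\<lambda>(t, r). mcv_pressure M \<Lambda> a (s M) t r) at_infinity
           (at p within (allowed_region M I a - Sigma0 M I a (s M))))
    \<and> ((\<forall>(t, r)\<in>R1 M I a (s M).
          \<not> weak_energy_condition (mcv_density \<Lambda> a t) (mcv_pressure M \<Lambda> a (s M) t r))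
       \<or> (\<forall>(t, r)\<in>R2 M I a (s M).
          \<not> weak_energy_condition (mcv_density \<Lambda> a t) (mcv_pressure M \<Lambda> a (s M) t r)))"
proof -
  interpret mcvittie M I a "s M" by unfold_locales (use assms in auto)
  have ec: "deriv (hubble a) t < 1 / (a t)\<^sup>2" if "t \<in> I" for t
  proof -
    \<comment> \<open>In the background sum \<open>\<Lambda>\<close> and the squares of the Hubble
      rate cancel, leaving the energy condition in terms of \<open>a\<close> alone.\<close>
    have "flrw_density \<Lambda> a t + flrw_pressure \<Lambda> a t =
        (1 / (a t)\<^sup>2 - deriv (hubble a) t) / (4 * pi)"
      by (simp add: flrw_density_def flrw_pressure_def field_simps)
    then show ?thesis using assms(8)[OF that] by (simp add: zero_less_divide_iff)
  qed
  have "C1_hypersurface (Sigma0 M I a (s M))"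
    unfolding Sigma0_graph by (rule C1_hypersurface_graph[OF open_T r0_C1])
  \<comment> \<open>The disjunction is settled by its first alternative in all cases.\<close>
  moreover have "\<forall>(t, r)\<in>R1 M I a (s M).
      \<not> weak_energy_condition (mcv_density \<Lambda> a t) (mcv_pressure M \<Lambda> a (s M) t r)"
    using energy_condition_violated[OF ec] by blast
  ultimately show ?thesis
    using sigma_unique_root Sigma0_allowed r0_C1 spacelike_mod_radical_Sigma0 spacelike_Sigma0
      pressure_at_infinity[OF ec] by blast
qed

end
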